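(* Let $\Omega\subset\mathbb{C}$ be a bounded connected open set, $\varphi:\mathbb{D}\to\Omega$ an analytic covering map, and $\overline\varphi$ its extension by radial limits. Let $p,q\in\overline\Omega$, let $\gamma$ be a path in $\Omega$ (e.p.e.) joining $p$ and $q$, and let $\widehat\gamma$ be a lift of $\gamma$ with endpoints $\widehat p,\widehat q\in\overline{\mathbb{D}}$. If $\lambda\in\overline{[\gamma]}$, then there is a continuous lift $\widehat\lambda:[0,1]\to\overline{\mathbb{D}}$ of $\lambda$ (i.e. $\overline\varphi\circ\widehat\lambda=\lambda$) with $\widehat\lambda(0)=\widehat p$, $\widehat\lambda(1)=\widehat q$. Conversely, if $\lambda:[0,1]\to\overline\Omega$ is a path joining $p$ and $q$ which has a continuous lift $\widehat\lambda:[0,1]\to\overline{\mathbb{D}}$ with $\widehat\lambda(0)=\widehat p$ and $\widehat\lambda(1)=\widehat q$, then $\lambda\in\overline{[\gamma]}$.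
   Context: $\mathbb{D}$ is the open unit disk. $\overline\varphi$ is defined on $\mathbb{D}\cup\{\alpha\in\partial\mathbb{D}:\lim_{r\to1^-}\varphi(r\alpha)\text{ exists}\}$ by $\overline\varphi=\varphi$ on $\mathbb{D}$ and radial limits on $\partial\mathbb{D}$. A lift of a path $\gamma$ is a continuous path $\widehat\gamma$ in the domain of $\overline\varphi$ with $\overline\varphi\circ\widehat\gamma=\gamma$. A path in $\Omega$ (e.p.e.) joining $p$ and $q$ is a continuous $\gamma:[0,1]\to\mathbb{C}$ with $\gamma(0)=p$, $\gamma(1)=q$, $\gamma((0,1))\subset\Omega$. $\overline{[\gamma]}$ is the set of paths $\lambda$ for which there is a continuous $h:[0,1]^2\to\mathbb{C}$ with $h(\cdot,0)=\gamma$, $h(\cdot,1)=\lambda$, and $h(\cdot,t)$ a path in $\Omega$ (e.p.e.) joining $p$ and $q$ for every $t\in[0,1)$. *)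

theory Defs
  imports "HOL-Complex_Analysis.Complex_Analysis"
begin

definition radial_dom :: "(complex \<Rightarrow> complex) \<Rightarrow> complex set" where
  "radial_dom \<phi> = ball 0 1 \<union>
     {\<alpha>. norm \<alpha> = 1 \<and> (\<exists>l. ((\<lambda>r::real. \<phi> (of_real r * \<alpha>)) \<longlongrightarrow> l) (at_left 1))}"

text \<open>The extension by radial limits (only meaningful on radial_dom).\<close>
definition radial_ext :: "(complex \<Rightarrow> complex) \<Rightarrow> complex \<Rightarrow> complex" where
  "radial_ext \<phi> z = (if z \<in> ball 0 1 then \<phi> z
      else Lim (at_left (1::real)) (\<lambda>r. \<phi> (of_real r * z)))"

definition is_lift :: "(complex \<Rightarrow> complex) \<Rightarrow> (real \<Rightarrow> complex) \<Rightarrow> (real \<Rightarrow> complex) \<Rightarrow> bool" where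
  "is_lift \<phi> \<gamma> g \<longleftrightarrow> continuous_on {0..1} g \<and> g ` {0..1} \<subseteq> radial_dom \<phi> \<and>
     (\<forall>s\<in>{0..1}. radial_ext \<phi> (g s) = \<gamma> s)"

definition path_epe :: "complex set \<Rightarrow> complex \<Rightarrow> complex \<Rightarrow> (real \<Rightarrow> complex) \<Rightarrow> bool" where
  "path_epe \<Omega> p q \<gamma> \<longleftrightarrow> continuous_on {0..1} \<gamma> \<and> \<gamma> 0 = p \<and> \<gamma> 1 = q \<and> \<gamma> ` {0<..<1} \<subseteq> \<Omega>"

definition hclass :: "complex set \<Rightarrow> complex \<Rightarrow> complex \<Rightarrow> (real \<Rightarrow> complex) \<Rightarrow> (real \<Rightarrow> complex) set" where
  "hclass \<Omega> p q \<gamma> = {lam. \<exists>h :: real \<times> real \<Rightarrow> complex.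
      continuous_on ({0..1} \<times> {0..1}) h \<and>
      (\<forall>s\<in>{0..1}. h (s, 0) = \<gamma> s \<and> h (s, 1) = lam s) \<and>
      (\<forall>t\<in>{0..<1}. path_epe \<Omega> p q (\<lambda>s. h (s, t)))}"

end

theory Submission
  imports Defs
begin

text \<open>
  Everything rests on one estimate for a bounded holomorphic \<open>f\<close> on the disk. If a path in the
  closed disk runs from one side to the other of a point \<open>z\<close> of a diameter, and \<open>f\<close> (in the sense of
  radial limits on the circle) is at most \<open>\<delta>\<close> along it, then the path and its mirror image in the
  diameter enclose \<open>z\<close>, and the maximum principle for the product of \<open>f\<close> and its reflection gives
  \<open>\<bar>f z\<bar>\<^sup>2 \<le> \<delta>\<close>. The maximum principle with merely radial boundary control is obtained from Baire's
  theorem.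

  Multiplying by exponential peak functions, the estimate yields Lindelof's theorem (an asymptotic
  value along a path is a radial limit) and Koebe's lemma (a nonconstant bounded function cannot be
  almost constant along paths joining neighbourhoods of two different boundary points). Koebe's lemma
  shows that the lift of a homotopy extends continuously to the closed square, and Lindelof's theorem
  identifies the values of the extension. For the converse, the estimate shows that
  \<open>(s, r) \<mapsto> \<phi> (r * l s)\<close> extends continuously to the closed square for every lift \<open>l\<close>; both
  \<open>gh\<close> and \<open>lh\<close> can therefore be deformed to the path made of the radii ending at \<open>ph\<close> and \<open>qh\<close>.
\<close>

section \<open>Maximum principles with exceptional points and radial boundary values\<close>

text \<open>The obstacle is that a lift may meet the unit circle in a large closed set, where
  \<open>f\<close> is controlled only along radii, whereas a maximum principle on a subdomain asks
  for control on every approach from inside it. Bridging this gap is what the use of Baire's theorem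
  is for. The square in the main estimate appears because at each point of the symmetric curve only
  one factor of the product is known to be small, while the other is merely at most 1; at
  \<open>z\<close> both factors have the same modulus. All such estimates are made for functions
  bounded by 1, which boundedness of \<open>\<Omega>\<close> provides after subtracting a value and
  scaling. Points without boundary control (corners of a sector, the end point of the path in
  Lindelof's theorem) are absorbed by multiplying \<open>f ^ N\<close> with a fixed polynomial that
  vanishes there and letting \<open>N\<close> grow. In the extension of the lifted homotopy Koebe's
  lemma covers limit sets that touch the circle; limit sets inside the disk are left to the identity
  theorem.\<close>

lemma exp_neg_le_ex:
  fixes B d :: real
  assumes "0 < B" "0 < d"
  obtains k where "0 \<le> k" "exp (- (k * d)) \<le> B"
proof
  have "exp (- \<bar>ln B\<bar>) \<le> exp (ln B)"
    by simp
  then show "exp (- (\<bar>ln B\<bar> / d * d)) \<le> B"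
    using assms by simp
  show "0 \<le> \<bar>ln B\<bar> / d"
    using assms by simp
qed

text \<open>The N-th root trick: factors independent of \<open>N\<close> disappear as
  \<open>N\<close> grows. It removes the auxiliary polynomials used below.\<close>

lemma le_of_power_mult_le:
  fixes a c k D :: real
  assumes "\<And>N. a ^ N * k \<le> c ^ N * D" and "0 < k" and "0 < c"
  shows "a \<le> c"
proof (rule ccontr)
  assume "\<not> a \<le> c"
  then have "1 < a / c"
    using assms(3) by simp
  then obtain N where N: "D / k < (a / c) ^ N"
    using real_arch_pow by blast
  have "D * c ^ N < a ^ N * k"
    using N assms(2,3) by (simp add: power_divide field_simps)
  with assms(1)[of N] show False
    by (simp add: mult.commute)
qed

text \<open>For \<open>c > B\<close> the set where \<open>norm f\<close> exceeds \<open>c\<close>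
  cannot accumulate at the frontier of \<open>R\<close>, so its closure lies in \<open>R\<close>.
  The classical principle applies to that set, and on its frontier \<open>norm f\<close> is at most
  \<open>c\<close>.\<close>

lemma maximum_modulus_limsup:
  assumes hol: "f holomorphic_on R" and "open R" and "bounded R"
    and lim: "\<And>y c. y \<in> frontier R \<Longrightarrow> B < c \<Longrightarrow> \<forall>\<^sub>F w in at y within R. norm (f w) \<le> c"
    and "z \<in> R"
  shows "norm (f z) \<le> B"
proof (rule ccontr)
  assume "\<not> norm (f z) \<le> B"
  then obtain c where c: "B < c" "c < norm (f z)"
    using dense not_le by metis
  define S where "S = {w \<in> R. c < norm (f w)}"
  have contf: "continuous_on R f"
    using hol by (rule holomorphic_on_imp_continuous_on)
  have "open S"
  proof -
    have "open (R \<inter> (\<lambda>w. norm (f w)) -` {c<..})"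
      by (intro continuous_open_preimage continuous_intros contf \<open>open R\<close>)
    then show ?thesis
      unfolding S_def by (simp add: vimage_def Int_def)
  qed
  have clS: "closure S \<subseteq> R"
  proof
    fix y assume y: "y \<in> closure S"
    show "y \<in> R"
    proof (rule ccontr)
      assume "y \<notin> R"
      have "y \<in> closure R"
        using y closure_mono[of S R] by (auto simp: S_def)
      then have "y \<in> frontier R"
        using \<open>y \<notin> R\<close> \<open>open R\<close> by (simp add: frontier_def interior_open)
      from lim[OF this c(1)] obtain T where T: "open T" "y \<in> T"
        "\<And>w. w \<in> T \<Longrightarrow> w \<noteq> y \<Longrightarrow> w \<in> R \<Longrightarrow> norm (f w) \<le> c"
        unfolding eventually_at_topological by blast
      then obtain w where "w \<in> T" "w \<in> S"
        using y by (meson closure_iff_nhds_not_empty IntE disjoint_iff open_Int_closure_eq_empty)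
      then show False
        using T(3)[of w] \<open>y \<notin> R\<close> by (auto simp: S_def)
    qed
  qed
  have "norm (f z) \<le> c"
  proof (rule maximum_modulus_frontier[of f S])
    show "f holomorphic_on interior S"
      using hol interior_subset[of S] by (auto simp: S_def elim!: holomorphic_on_subset)
    show "continuous_on (closure S) f"
      using contf clS continuous_on_subset by blast
    show "bounded S"
      using \<open>bounded R\<close> by (auto simp: S_def intro: bounded_subset)
    show "norm (f w) \<le> c" if "w \<in> frontier S" for w
    proof -
      have "w \<in> R" "w \<notin> S"
        using that clS \<open>open S\<close> by (auto simp: frontier_def interior_open)
      then show ?thesis
        by (simp add: S_def)
    qed
    show "z \<in> S"
      using c \<open>z \<in> R\<close> by (simp add: S_def)
  qed
  with c show False by simp
qed

text \<open>Near a point of \<open>X\<close> the product \<open>f ^ N * p\<close> tends to 0 because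
  \<open>f\<close> is bounded, so the limsup principle applies to it with the bound
  \<open>c ^ N * D\<close> on the entire frontier. Enlarging \<open>B\<close> to \<open>c\<close>
  makes this bound positive.\<close>

lemma maximum_modulus_limsup_finite_exceptions:
  assumes hol: "f holomorphic_on R" and "open R" and "bounded R"
    and bd: "\<And>w. w \<in> R \<Longrightarrow> norm (f w) \<le> 1"
    and X: "finite X" "X \<inter> R = {}"
    and lim: "\<And>y c. y \<in> frontier R - X \<Longrightarrow> B < c \<Longrightarrow> \<forall>\<^sub>F w in at y within R. norm (f w) \<le> c"
    and "0 \<le> B" and "z \<in> R"
  shows "norm (f z) \<le> B"
proof (rule field_le_epsilon)
  fix e :: real assume "0 < e"
  define c where "c = B + e"
  have c: "0 < c" "B < c"
    using \<open>0 \<le> B\<close> \<open>0 < e\<close> by (auto simp: c_def)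
  define p where "p = (\<lambda>w. \<Prod>x\<in>X. (w - x))"
  have contp: "continuous_on UNIV p"
    unfolding p_def by (intro continuous_intros)
  have "compact (p ` closure R)"
    using \<open>bounded R\<close> by (intro compact_continuous_image continuous_on_subset[OF contp]) auto
  then obtain D where D: "0 < D" "\<And>w. w \<in> R \<Longrightarrow> norm (p w) \<le> D"
    by (metis bounded_pos closure_subset compact_imp_bounded image_eqI subsetD)
  have pz: "0 < norm (p z)"
    using X \<open>z \<in> R\<close> by (auto simp: p_def)
  have "norm (f z) ^ N * norm (p z) \<le> c ^ N * D" for N
  proof -
    have "norm (f z ^ N * p z) \<le> c ^ N * D"
    proof (rule maximum_modulus_limsup[of "\<lambda>w. f w ^ N * p w" R])
      show "(\<lambda>w. f w ^ N * p w) holomorphic_on R"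
        unfolding p_def by (intro holomorphic_intros hol)
      fix y c' assume y: "y \<in> frontier R" and c': "c ^ N * D < c'"
      have inR: "\<forall>\<^sub>F w in at y within R. w \<in> R"
        by (auto simp: eventually_at_topological)
      show "\<forall>\<^sub>F w in at y within R. norm (f w ^ N * p w) \<le> c'"
      proof (cases "y \<in> X")
        case False
        with y have "\<forall>\<^sub>F w in at y within R. norm (f w) \<le> c"
          using lim c by auto
        with inR show ?thesis
        proof eventually_elim
          case (elim w)
          have "norm (f w ^ N * p w) \<le> c ^ N * D"
            using elim D(2)[of w] c by (auto simp: norm_mult norm_power intro!: mult_mono power_mono)
          then show ?case
            using c' by simp
        qed
      next
        case True
        have "(p \<longlongrightarrow> p y) (at y within R)"
          using contp by (auto simp: continuous_on_eq_continuous_at intro: isContD tendsto_within_subset)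
        moreover have "p y = 0"
          using True X by (auto simp: p_def)
        moreover have "0 < c ^ N * D"
          using c D by simp
        ultimately have "\<forall>\<^sub>F w in at y within R. dist (p w) 0 < c ^ N * D"
          by (metis tendstoD)
        with inR show ?thesis
        proof eventually_elim
          case (elim w)
          have "norm (f w ^ N * p w) \<le> 1 * norm (p w)"
            unfolding norm_mult norm_power using bd[OF elim(1)]
            by (intro mult_right_mono power_le_one) auto
          then show ?case
            using c' elim by simp
        qed
      qed
    qed (use assms in auto)
    then show ?thesis
      by (simp add: norm_mult norm_power)
  qed
  from le_of_power_mult_le[OF this pz c(1)] show "norm (f z) \<le> B + e"
    by (simp add: c_def)
qed

section \<open>Boundary control along radii only\<close>

lemma Baire_closed_cover:
  fixes P :: "'a::{real_normed_vector,heine_borel} set"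
  assumes "closed P" "P \<noteq> {}" and clA: "\<And>n::nat. closed (A n)" and "P \<subseteq> (\<Union>n. A n)"
  obtains n a d where "a \<in> P" "0 < d" "P \<inter> ball a d \<subseteq> A n"
proof -
  have "\<exists>n. \<not> P \<subseteq> closure (P - A n)"
  proof (rule ccontr)
    assume "\<not> ?thesis"
    then have "P \<subseteq> closure (\<Inter>n. P - A n)"
      using Baire[OF \<open>closed P\<close>, of "range (\<lambda>n. P - A n)"] clA
      by (auto simp: Diff_eq intro!: openin_open_Int)
    moreover have "(\<Inter>n. P - A n) = {}"
      using \<open>P \<subseteq> (\<Union>n. A n)\<close> by auto
    ultimately have "P \<subseteq> {}"
      by (simp only: closure_empty)
    then show False
      using \<open>P \<noteq> {}\<close> by simp
  qed
  then obtain n a where a: "a \<in> P" "a \<notin> closure (P - A n)"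
    by blast
  then obtain d where "0 < d" "ball a d \<inter> (P - A n) = {}"
    by (metis closure_approachable disjoint_iff dist_commute mem_ball)
  with a show thesis
    using that[of a d n] by blast
qed

text \<open>Guarantees that a point close to \<beta> lies on a radius whose end point is still close
  to \<beta>. The factor 2 arises because the projection itself moves \<open>w\<close> by at most
  \<open>norm (w - \<beta>)\<close>.\<close>

lemma norm_radial_projection_diff_le:
  fixes w \<beta> :: "'a::real_normed_vector"
  assumes "norm \<beta> = 1" "w \<noteq> 0"
  shows "norm (w /\<^sub>R norm w - \<beta>) \<le> 2 * norm (w - \<beta>)"
proof -
  have "norm (w /\<^sub>R norm w - w) = \<bar>norm \<beta> - norm w\<bar>"
  proof -
    have "w /\<^sub>R norm w - w = (inverse (norm w) - 1) *\<^sub>R w"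
      by (simp add: scaleR_left_diff_distrib)
    then have "norm (w /\<^sub>R norm w - w) = \<bar>(inverse (norm w) - 1) * norm w\<bar>"
      by (simp add: abs_mult)
    also have "(inverse (norm w) - 1) * norm w = norm \<beta> - norm w"
      using assms by (simp add: field_simps)
    finally show ?thesis .
  qed
  also have "\<dots> \<le> norm (w - \<beta>)"
    by (metis norm_triangle_ineq3 norm_minus_commute)
  finally show ?thesis
    using norm_triangle_ineq[of "w /\<^sub>R norm w - w" "w - \<beta>"] by simp
qed

text \<open>Quantifies the peak functions \<open>exp (k * (w * cnj \<beta> - 1))\<close>: for
  \<open>k \<ge> 0\<close> their modulus is at most \<open>exp (- (k * d\<^sup>2 / 2))\<close> at
  points of the closed disk at distance \<open>d\<close> from \<beta>.\<close>

lemma Re_mult_cnj_le: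
  assumes "norm \<beta> = 1" "norm w \<le> 1"
  shows "Re (w * cnj \<beta>) \<le> 1 - (norm (w - \<beta>))\<^sup>2 / 2"
proof -
  have "(norm (w - \<beta>))\<^sup>2 = (norm w)\<^sup>2 + (norm \<beta>)\<^sup>2 - 2 * Re (w * cnj \<beta>)"
    by (simp only: cmod_power2) (simp add: power2_eq_square algebra_simps)
  moreover have "(norm w)\<^sup>2 \<le> 1"
    using assms by (simp add: power_le_one)
  ultimately show ?thesis
    using \<open>norm \<beta> = 1\<close> by (simp add: field_simps)
qed

text \<open>A circle point is \<open>good\<close> if the bound holds on unrestricted approach from
  inside \<open>C\<close>; if all are good, the limsup principle finishes. A nonempty bad set
  \<open>P\<close> would have a portion over which the radial bound is uniform. Radii over this
  portion cut the disk near it into sectors whose frontiers are controlled, so every circle point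
  near the portion turns out to be good, a contradiction.\<close>

lemma maximum_modulus_radial:
  assumes hol: "f holomorphic_on ball 0 1"
    and bd: "\<And>w. w \<in> ball 0 1 \<Longrightarrow> norm (f w) \<le> 1"
    and C: "open C" "C \<subseteq> ball 0 1"
    and fr: "\<And>w. w \<in> frontier C \<inter> ball 0 1 \<Longrightarrow> norm (f w) \<le> B"
    and rad: "\<And>\<alpha> c. \<alpha> \<in> frontier C \<inter> sphere 0 1 \<Longrightarrow> B < c \<Longrightarrow>
               \<forall>\<^sub>F r in at_left 1. norm (f (of_real r * \<alpha>)) \<le> c"
    and "0 \<le> B" and "z \<in> C"
  shows "norm (f z) \<le> B"
proof (rule field_le_epsilon)
  fix e :: real assume "0 < e"
  define b where "b = B + e"
  have b: "0 < b" "B < b"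
    using \<open>0 \<le> B\<close> \<open>0 < e\<close> by (auto simp: b_def)
  have contf: "isCont f w" if "w \<in> ball 0 1" for w
    using hol that by (metis at_within_open centre_in_ball continuous_on_eq_continuous_within
        holomorphic_on_imp_continuous_on open_ball)
  have clC: "closure C \<subseteq> cball 0 1"
    using C closure_mono[of C "ball 0 1"] by simp
  have frC: "y \<in> frontier C" if "y \<in> closure C" "y \<notin> C" for y
    using that C by (simp add: frontier_def interior_open)
  define good where
    "good = {\<alpha> \<in> sphere 0 1. \<forall>c>b. \<forall>\<^sub>F w in at \<alpha> within C. norm (f w) \<le> c}"
  \<comment> \<open>The relative interior of \<open>good\<close> in the circle, written as a set
    that is open in the plane; points off the circle belong to it vacuously when a small disk about
    them misses the circle. Openness makes \<open>P\<close> closed, as Baire's theorem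
    requires.\<close>
  define G where "G = {\<alpha>. \<exists>d>0. sphere 0 1 \<inter> ball \<alpha> d \<subseteq> good}"
  have "open G"
    unfolding open_dist
  proof (intro ballI)
    fix \<alpha> assume "\<alpha> \<in> G"
    then obtain d where d: "0 < d" "sphere 0 1 \<inter> ball \<alpha> d \<subseteq> good"
      by (auto simp: G_def)
    show "\<exists>e>0. \<forall>y. dist y \<alpha> < e \<longrightarrow> y \<in> G"
    proof (intro exI[of _ "d/2"] conjI allI impI)
      fix y assume "dist y \<alpha> < d/2"
      then have "dist \<alpha> t < d" if "dist y t < d/2" for t
        using dist_triangle[of \<alpha> t y] that by (simp add: dist_commute)
      then have "ball y (d/2) \<subseteq> ball \<alpha> d"
        by auto
      then show "y \<in> G"
        using d unfolding G_def by (auto intro!: exI[of _ "d/2"])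
    qed (use d in auto)
  qed
  define P where "P = sphere 0 1 - G"
  have "closed P"
    using \<open>open G\<close> by (simp add: P_def closed_Diff)
  have goodG: "\<alpha> \<in> good" if "\<alpha> \<in> sphere 0 1" "\<alpha> \<notin> P" for \<alpha>
    using that by (force simp: P_def G_def)
  \<comment> \<open>\<open>f\<close> is radially bounded at every point of \<open>P\<close>, so by Baire uniformly on a portion of \<open>P\<close>.\<close>
  have "P = {}"
  proof (rule ccontr)
    assume "P \<noteq> {}"
    \<comment> \<open>The hypothesis \<open>rad\<close> speaks of frontier points of
      \<open>C\<close> only. Circle points off the closure of \<open>C\<close> are good vacuously,
      since the filter at them within \<open>C\<close> is trivial.\<close>
    have PC: "P \<subseteq> frontier C"
    proof
      fix \<alpha> assume \<alpha>: "\<alpha> \<in> P"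
      have "\<alpha> \<in> closure C"
      proof (rule ccontr)
        assume "\<alpha> \<notin> closure C"
        then obtain d where d: "0 < d" "ball \<alpha> d \<subseteq> - closure C"
          by (metis ComplI closed_closure open_Compl open_contains_ball)
        have "\<beta> \<in> good" if "\<beta> \<in> sphere 0 1 \<inter> ball \<alpha> d" for \<beta>
        proof -
          have "\<beta> \<notin> closure C"
            using that d by auto
          then have "at \<beta> within C = bot"
            by (metis closure_def UnCI at_within_eq_bot_iff not_in_closure_trivial_limitI trivial_limit_def)
          then show ?thesis
            using that by (simp add: good_def)
        qed
        then have "\<alpha> \<in> G"
          using d by (auto simp: G_def)
        with \<alpha> show False by (simp add: P_def)
      qed
      moreover have "\<alpha> \<notin> C"
        using \<alpha> C by (auto simp: P_def)
      ultimately show "\<alpha> \<in> frontier C"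
        by (rule frC)
    qed
    define A where "A = (\<lambda>n::nat. {\<alpha> \<in> sphere 0 1. \<forall>r\<in>{1 - 1/(real n + 1)..<1}. norm (f (of_real r * \<alpha>)) \<le> b})"
    have "closed (A n)" for n
    proof -
      have "A n = sphere 0 1 \<inter> (\<Inter>r\<in>{1 - 1/(real n + 1)..<1}. {\<alpha> \<in> sphere 0 1. norm (f (of_real r * \<alpha>)) \<le> b})"
        by (auto simp: A_def)
      moreover have "closed {\<alpha> \<in> sphere 0 1. norm (f (of_real r * \<alpha>)) \<le> b}"
        if r: "r \<in> {1 - 1/(real n + 1)..<1}" for r
      proof -
        have "1 / (real n + 1) \<le> 1"
          by simp
        then have r0: "0 \<le> r" "r < 1"
          using r unfolding atLeastLessThan_iff by linarith+
        have "continuous_on (sphere 0 1) (\<lambda>\<alpha>. norm (f (of_real r * \<alpha>)))"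
          using r0 by (intro continuous_intros continuous_on_compose2[OF holomorphic_on_imp_continuous_on[OF hol]])
            (auto simp: norm_mult)
        then have "closed (sphere 0 1 \<inter> (\<lambda>\<alpha>. norm (f (of_real r * \<alpha>))) -` {..b})"
          by (intro continuous_closed_preimage) auto
        then show ?thesis
          by (simp add: vimage_def Int_def)
      qed
      ultimately show ?thesis
        by (metis (no_types, lifting) closed_Int closed_INT closed_sphere)
    qed
    moreover have "P \<subseteq> (\<Union>n. A n)"
    proof
      fix \<alpha> assume \<alpha>: "\<alpha> \<in> P"
      then have "\<forall>\<^sub>F r in at_left 1. norm (f (of_real r * \<alpha>)) \<le> b"
        using rad[of \<alpha> b] PC b by (auto simp: P_def)
      then obtain r0 where r0: "r0 < 1" "\<And>r. r0 < r \<Longrightarrow> r < 1 \<Longrightarrow> norm (f (of_real r * \<alpha>)) \<le> b"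
        unfolding eventually_at_left_field by blast
      obtain n :: nat where "1 / (1 - r0) < real n"
        using reals_Archimedean2 by blast
      then have n: "1 / (real n + 1) < 1 - r0"
        using r0 by (simp add: field_simps)
      have "\<alpha> \<in> A n"
        using \<alpha> n r0(2) by (auto simp: A_def P_def)
      then show "\<alpha> \<in> (\<Union>n. A n)" by blast
    qed
    ultimately obtain n a d where a: "a \<in> P" "0 < d" "P \<inter> ball a d \<subseteq> A n"
      using Baire_closed_cover[OF \<open>closed P\<close> \<open>P \<noteq> {}\<close>] by metis
    have "\<beta> \<in> good" if \<beta>: "\<beta> \<in> sphere 0 1 \<inter> ball a d" for \<beta>
    proof (cases "\<beta> \<in> P")
      case False
      then show ?thesis
        using goodG \<beta> by blast
    next
      case True
      have n\<beta>: "norm \<beta> = 1"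
        using \<beta> by simp
      then have \<beta>cnj: "\<beta> * cnj \<beta> = 1"
        by (metis complex_norm_square of_real_1 power_one)
      \<comment> \<open>Three demands: points of the disk in this ball have norms in the range
        covered by \<open>A n\<close>; \<open>w * cnj \<beta>\<close> stays in the right half plane,
        where \<open>Arg\<close> is continuous; and, as radial projection at most doubles the
        distance to \<beta>, their directions stay in \<open>ball a d\<close>.\<close>
      define \<eta> where "\<eta> = min (1 / (real n + 1)) (min (1/2) ((d - dist a \<beta>) / 2))"
      have \<eta>2: "\<eta> \<le> (d - dist a \<beta>) / 2"
        unfolding \<eta>_def by (intro min.coboundedI2 order_refl)
      have \<eta>: "0 < \<eta>" "\<eta> \<le> 1 / (real n + 1)" "\<eta> \<le> 1/2"
        using \<beta> by (auto simp: \<eta>_def)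
      define ang where "ang = (\<lambda>w. Arg (w * cnj \<beta>))"
      have rot: "norm (w * cnj \<beta> - 1) = norm (w - \<beta>)" for w
      proof -
        have "w * cnj \<beta> - 1 = (w - \<beta>) * cnj \<beta>"
          by (simp add: \<beta>cnj algebra_simps)
        then show ?thesis
          by (simp add: norm_mult n\<beta>)
      qed
      have Repos: "0 < Re (w * cnj \<beta>)" if "w \<in> ball \<beta> \<eta>" for w
      proof -
        have "norm (w * cnj \<beta> - 1) < 1/2"
          using that \<eta> rot[of w] by (simp add: dist_norm norm_minus_commute)
        then have "\<bar>Re (w * cnj \<beta> - 1)\<bar> < 1/2"
          using abs_Re_le_cmod le_less_trans by blast
        then show ?thesis
          unfolding abs_less_iff by simp
      qed
      have polar: "w = of_real (norm w) * (\<beta> * cis (ang w))" for w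
      proof -
        have "w * cnj \<beta> = of_real (norm w) * cis (ang w)"
          using rcis_cmod_Arg[of "w * cnj \<beta>"] by (simp add: rcis_def ang_def norm_mult n\<beta>)
        then have "w * (\<beta> * cnj \<beta>) = of_real (norm w) * (\<beta> * cis (ang w))"
          by (metis mult.assoc mult.commute)
        then show ?thesis
          by (simp only: \<beta>cnj mult_1_right)
      qed
      have contang: "continuous_on (ball \<beta> \<eta>) ang"
        unfolding ang_def using Repos
        by (intro continuous_on_compose2[OF continuous_on_Arg] continuous_intros)
          (force simp: complex_nonpos_Reals_iff)
      have ang_pi: "- pi < ang w" "ang w < pi" if "w \<in> ball \<beta> \<eta>" for w
        using Repos[OF that] Arg_bounded[of "w * cnj \<beta>"] Arg_eq_pi[of "w * cnj \<beta>"]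
        by (auto simp: ang_def less_le)
      \<comment> \<open>The artificial angles \<open>-pi\<close> and \<open>pi\<close> guarantee an
        element of \<open>\<Theta>\<close> on either side of every angle. On the ball
        \<open>ang\<close> never attains them, so they do not disturb the bound over
        \<open>\<Theta>\<close>.\<close>
      define \<Theta> where "\<Theta> = {\<theta> \<in> {-pi..pi}. \<beta> * cis \<theta> \<in> P} \<union> {-pi, pi}"
      have cont_cis: "continuous_on UNIV (\<lambda>\<theta>. \<beta> * cis \<theta>)"
        by (intro continuous_intros)
      have "compact \<Theta>"
      proof -
        have "closed ((\<lambda>\<theta>. \<beta> * cis \<theta>) -` P)"
          using cont_cis \<open>closed P\<close> by (simp add: closed_vimage)
        then have "compact ({-pi..pi} \<inter> (\<lambda>\<theta>. \<beta> * cis \<theta>) -` P)"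
          by (intro compact_Int_closed) auto
        moreover have "\<Theta> = ({-pi..pi} \<inter> (\<lambda>\<theta>. \<beta> * cis \<theta>) -` P) \<union> {-pi, pi}"
          by (auto simp: \<Theta>_def)
        ultimately show ?thesis
          by (simp add: compact_Un)
      qed
      have f\<Theta>: "norm (f w) \<le> b" if w: "w \<in> ball \<beta> \<eta>" "norm w < 1" "ang w \<in> \<Theta>" for w
      proof -
        define u where "u = \<beta> * cis (ang w)"
        have u: "u \<in> P"
          using w(3) ang_pi[OF w(1)] by (auto simp: \<Theta>_def u_def)
        have nw: "1 - \<eta> < norm w"
          using w(1) norm_triangle_ineq2[of \<beta> w] n\<beta> by (simp add: dist_norm)
        then have "w \<noteq> 0"
          using \<eta> by auto
        have wu: "w = of_real (norm w) * u"
          unfolding u_def by (rule polar)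
        then have "u = w /\<^sub>R norm w"
          using \<open>w \<noteq> 0\<close> by (metis norm_eq_zero of_real_eq_0_iff nonzero_mult_div_cancel_left scaleR_conv_of_real divide_inverse_commute of_real_inverse)
        then have "norm (u - \<beta>) \<le> 2 * norm (w - \<beta>)"
          using norm_radial_projection_diff_le[OF n\<beta> \<open>w \<noteq> 0\<close>] by simp
        also have "\<dots> < 2 * \<eta>"
          using w(1) by (simp add: dist_norm norm_minus_commute)
        finally have "dist \<beta> u < d - dist a \<beta>"
          using \<eta>2 by (simp add: dist_norm norm_minus_commute)
        then have "u \<in> ball a d"
          using dist_triangle[of a u \<beta>] by simp
        then have "u \<in> A n"
          using a u by blast
        then have "norm (f (of_real (norm w) * u)) \<le> b"
          using nw \<eta>(2) w(2) by (auto simp: A_def)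
        then show ?thesis
          using wu by simp
      qed
      obtain k where k: "0 \<le> k" "exp (- (k * (\<eta>\<^sup>2 / 2))) \<le> b"
        using exp_neg_le_ex[OF b(1), of "\<eta>\<^sup>2 / 2"] \<eta>(1) by auto
      \<comment> \<open>A peak function at \<open>\<beta>\<close>; it removes the unknown values of \<open>f\<close> at distance \<open>\<eta>\<close> from \<open>\<beta>\<close>.\<close>
      define E where "E = (\<lambda>w. exp (of_real k * (w * cnj \<beta> - 1)))"
      have nE: "norm (E w) = exp (k * (Re (w * cnj \<beta>) - 1))" for w
        by (simp add: E_def)
      have E1: "norm (E w) \<le> 1" if "norm w \<le> 1" for w
      proof -
        have "Re (w * cnj \<beta>) \<le> 1"
          using Re_mult_cnj_le[OF n\<beta> that] zero_le_power2[of "norm (w - \<beta>)"] by linarith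
        then show ?thesis
          using k(1) by (auto simp: nE intro: mult_nonneg_nonpos)
      qed
      define F where "F = (\<lambda>w. f w * E w)"
      have contF: "isCont F w" if "norm w < 1" for w
        unfolding F_def E_def using contf[of w] that by (intro continuous_intros) auto
      have FleF: "norm (F w) \<le> norm (f w)" if "norm w \<le> 1" for w
        using E1[OF that] mult_left_le[of "norm (E w)" "norm (f w)"] by (simp add: F_def norm_mult)
      have claim: "norm (F w0) \<le> b" if w0: "w0 \<in> C" "w0 \<in> ball \<beta> \<eta>" for w0
      proof (cases "ang w0 \<in> \<Theta>")
        case True
        then show ?thesis
          using f\<Theta>[of w0] FleF[of w0] w0 C by force
      next
        case False
        \<comment> \<open>Work in the sector over the gap of \<open>P\<close> containing the direction of \<open>w0\<close>: its sides are radii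
          on which \<open>f\<close> is already bounded, and only its two corners on the circle are exceptional.\<close>
        define \<theta>0 where "\<theta>0 = ang w0"
        have \<theta>0: "- pi < \<theta>0" "\<theta>0 < pi" "\<theta>0 \<notin> \<Theta>"
          using ang_pi[OF w0(2)] False by (auto simp: \<theta>0_def)
        obtain lo where lo: "lo \<in> \<Theta>" "lo \<le> \<theta>0" "\<And>\<theta>. \<theta> \<in> \<Theta> \<Longrightarrow> \<theta> \<le> \<theta>0 \<Longrightarrow> \<theta> \<le> lo"
        proof -
          have "compact (\<Theta> \<inter> {..\<theta>0})"
            using \<open>compact \<Theta>\<close> by (simp add: compact_Int_closed)
          moreover have "\<Theta> \<inter> {..\<theta>0} \<noteq> {}"
            using \<theta>0 by (auto simp: \<Theta>_def)
          ultimately show thesis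
            using that compact_attains_sup[of "\<Theta> \<inter> {..\<theta>0}"] by auto
        qed
        obtain hi where hi: "hi \<in> \<Theta>" "\<theta>0 \<le> hi" "\<And>\<theta>. \<theta> \<in> \<Theta> \<Longrightarrow> \<theta>0 \<le> \<theta> \<Longrightarrow> hi \<le> \<theta>"
        proof -
          have "compact (\<Theta> \<inter> {\<theta>0..})"
            using \<open>compact \<Theta>\<close> by (simp add: compact_Int_closed)
          moreover have "\<Theta> \<inter> {\<theta>0..} \<noteq> {}"
            using \<theta>0 by (auto simp: \<Theta>_def)
          ultimately show thesis
            using that compact_attains_inf[of "\<Theta> \<inter> {\<theta>0..}"] by auto
        qed
        have lohi: "lo < \<theta>0" "\<theta>0 < hi"
          using lo hi \<theta>0 by (auto simp: less_le)
        have gap: "\<theta> \<notin> \<Theta>" if "lo < \<theta>" "\<theta> < hi" for \<theta>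
          using lo(3)[of \<theta>] hi(3)[of \<theta>] that by linarith
        define R where "R = C \<inter> (ball \<beta> \<eta> \<inter> ang -` {lo<..<hi})"
        have RC: "R \<subseteq> C" "R \<subseteq> ball 0 1"
          using C by (auto simp: R_def)
        have "open R"
          unfolding R_def
          by (intro open_Int C continuous_open_preimage contang) auto
        have clR: "closure R \<subseteq> closure C" "closure R \<subseteq> cball \<beta> \<eta>"
        proof -
          show "closure R \<subseteq> closure C"
            by (rule closure_mono) (auto simp: R_def)
          have "R \<subseteq> cball \<beta> \<eta>"
            by (auto simp: R_def)
          then show "closure R \<subseteq> cball \<beta> \<eta>"
            by (simp add: closure_minimal)
        qed
        define X where "X = {\<beta> * cis lo, \<beta> * cis hi}"
        show ?thesis
        proof (rule maximum_modulus_limsup_finite_exceptions[of F R X])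
          show "F holomorphic_on R"
            unfolding F_def E_def using hol RC
            by (intro holomorphic_intros) (auto elim: holomorphic_on_subset)
          show "bounded R"
            using RC bounded_subset bounded_ball by blast
          show "norm (F w) \<le> 1" if "w \<in> R" for w
            using bd[of w] FleF[of w] RC(2) that by force
          show "X \<inter> R = {}"
            using RC(2) n\<beta> by (auto simp: X_def norm_mult)
          show "w0 \<in> R"
            using w0 lohi by (simp add: R_def \<theta>0_def)
          \<comment> \<open>A frontier point of \<open>R\<close> outside \<open>X\<close> is of one
            of four kinds: at distance \<eta> from \<beta>, where \<open>E\<close> is at most
            \<open>b\<close>; inside the disk on a side of the sector; inside the disk on the
            frontier of \<open>C\<close>; or on the unit circle strictly between the corners, hence
            outside \<open>P\<close> and good.\<close>
          fix y c assume y: "y \<in> frontier R - X" and c: "b < c"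
          then have y': "y \<in> closure R" "y \<notin> R"
            using \<open>open R\<close> by (auto simp: frontier_def interior_open)
          then have ny: "norm y \<le> 1"
            using clR clC by force
          have inR: "\<forall>\<^sub>F w in at y within R. w \<in> R"
            by (auto simp: eventually_at_topological)
          show "\<forall>\<^sub>F w in at y within R. norm (F w) \<le> c"
          proof (cases "y \<in> ball \<beta> \<eta>")
            case False
            then have "norm (y - \<beta>) = \<eta>"
              using y' clR by (force simp: dist_norm norm_minus_commute)
            then have "k * (Re (y * cnj \<beta>) - 1) \<le> k * (- (\<eta>\<^sup>2 / 2))"
              using Re_mult_cnj_le[OF n\<beta> ny] k(1) by (intro mult_left_mono) auto
            then have "norm (E y) \<le> exp (- (k * (\<eta>\<^sup>2 / 2)))"
              unfolding nE by simp
            then have "norm (E y) < c"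
              using k(2) c by linarith
            moreover have "((\<lambda>w. norm (E w)) \<longlongrightarrow> norm (E y)) (at y within R)"
              unfolding E_def by (intro tendsto_intros)
            ultimately have "\<forall>\<^sub>F w in at y within R. norm (E w) < c"
              by (rule order_tendstoD(2)[rotated])
            with inR show ?thesis
            proof eventually_elim
              case (elim w)
              have "norm (F w) \<le> 1 * norm (E w)"
                unfolding F_def norm_mult using bd[of w] elim RC
                by (intro mult_right_mono) auto
              with elim show ?case by simp
            qed
          next
            case yb: True
            have angy: "lo \<le> ang y" "ang y \<le> hi"
            proof -
              have "open (ball \<beta> \<eta> \<inter> ang -` (- {lo..hi}))"
                by (intro continuous_open_preimage contang) auto
              moreover have "(ball \<beta> \<eta> \<inter> ang -` (- {lo..hi})) \<inter> R = {}"
                by (auto simp: R_def)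
              ultimately have "(ball \<beta> \<eta> \<inter> ang -` (- {lo..hi})) \<inter> closure R = {}"
                by (simp add: open_Int_closure_eq_empty)
              then show "lo \<le> ang y" "ang y \<le> hi"
                using yb y'(1) by auto
            qed
            show ?thesis
            proof (cases "norm y < 1")
              case True
              have "norm (f y) \<le> b"
              proof (cases "y \<in> C")
                case yC: True
                then have "ang y = lo \<or> ang y = hi"
                  using y'(2) angy yb by (auto simp: R_def)
                then show ?thesis
                  using f\<Theta>[OF yb True] lo hi by auto
              next
                case False
                then have "y \<in> frontier C"
                  using y' clR frC by blast
                then show ?thesis
                  using fr[of y] True b by force
              qed
              then have "norm (F y) < c"
                using FleF[of y] c ny by linarith
              moreover have "((\<lambda>w. norm (F w)) \<longlongrightarrow> norm (F y)) (at y within R)"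
                using contF[OF True] by (intro tendsto_norm tendsto_within_subset[OF isContD]) auto
              ultimately show ?thesis
                by (metis (mono_tags, lifting) eventually_mono less_imp_le order_tendstoD(2))
            next
              case False
              then have ny1: "norm y = 1"
                using ny by simp
              then have yang: "y = \<beta> * cis (ang y)"
                using polar[of y] by simp
              then have "ang y \<noteq> lo" "ang y \<noteq> hi"
                using y by (auto simp: X_def)
              then have "ang y \<notin> \<Theta>"
                using gap angy by (simp add: less_le)
              then have "y \<notin> P"
                using yang ang_pi[OF yb] by (auto simp: \<Theta>_def)
              then have "y \<in> good"
                using goodG ny1 by simp
              then have "\<forall>\<^sub>F w in at y within C. norm (f w) \<le> c"
                using c by (simp add: good_def)
              then have "\<forall>\<^sub>F w in at y within R. norm (f w) \<le> c"
                using RC(1) at_le filter_leD by blast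
              with inR show ?thesis
              proof eventually_elim
                case (elim w)
                then show ?case
                  using FleF[of w] RC(2) by force
              qed
            qed
          qed
        qed (use \<open>open R\<close> b in \<open>auto simp: X_def\<close>)
      qed
      \<comment> \<open>Undoing the peak function costs a factor that tends to 1 at \<beta>, so the
        bound on \<open>F\<close> near \<beta> becomes a limsup bound on \<open>f\<close> at
        \<beta>.\<close>
      have "\<forall>\<^sub>F w in at \<beta> within C. norm (f w) \<le> c" if "b < c" for c
      proof -
        have "((\<lambda>w. b * exp (k * (1 - Re (w * cnj \<beta>)))) \<longlongrightarrow> b * exp (k * (1 - Re (\<beta> * cnj \<beta>)))) (at \<beta> within C)"
          by (intro tendsto_intros)
        then have "((\<lambda>w. b * exp (k * (1 - Re (w * cnj \<beta>)))) \<longlongrightarrow> b) (at \<beta> within C)"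
          by (simp add: \<beta>cnj)
        then have "\<forall>\<^sub>F w in at \<beta> within C. b * exp (k * (1 - Re (w * cnj \<beta>))) < c"
          using that by (rule order_tendstoD(2))
        moreover have "\<forall>\<^sub>F w in at \<beta> within C. w \<in> C \<inter> ball \<beta> \<eta>"
          using \<eta>(1) by (auto simp: eventually_at_topological intro!: exI[of _ "ball \<beta> \<eta>"])
        ultimately show ?thesis
        proof eventually_elim
          case (elim w)
          have "norm (f w) * exp (k * (Re (w * cnj \<beta>) - 1)) \<le> b"
            using claim[of w] elim by (simp add: F_def norm_mult nE)
          then have "norm (f w) * exp (k * (Re (w * cnj \<beta>) - 1)) * exp (k * (1 - Re (w * cnj \<beta>)))
              \<le> b * exp (k * (1 - Re (w * cnj \<beta>)))"
            by (intro mult_right_mono) auto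
          also have "norm (f w) * exp (k * (Re (w * cnj \<beta>) - 1)) * exp (k * (1 - Re (w * cnj \<beta>))) = norm (f w)"
            by (simp add: mult.assoc algebra_simps flip: exp_add)
          finally show ?case
            using elim by simp
        qed
      qed
      then show ?thesis
        using n\<beta> by (simp add: good_def)
    qed
    then have "a \<in> G"
      using a by (auto simp: G_def)
    with a show False
      by (simp add: P_def)
  qed
  have "norm (f z) \<le> b"
  proof (rule maximum_modulus_limsup[of f C])
    show "f holomorphic_on C"
      using hol C holomorphic_on_subset by blast
    show "bounded C"
      using C bounded_subset by blast
    fix y c assume y: "y \<in> frontier C" and c: "b < c"
    show "\<forall>\<^sub>F w in at y within C. norm (f w) \<le> c"
    proof (cases "norm y < 1")
      case True
      then have "norm (f y) < c"
        using fr[of y] y b c by auto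
      moreover have "((\<lambda>w. norm (f w)) \<longlongrightarrow> norm (f y)) (at y within C)"
        using contf[of y] True by (intro tendsto_norm tendsto_within_subset[OF isContD]) auto
      ultimately show ?thesis
        by (metis (mono_tags, lifting) eventually_mono less_imp_le order_tendstoD(2))
    next
      case False
      then have "y \<in> sphere 0 1"
        using y clC by (force simp: frontier_def)
      then have "y \<in> good"
        using goodG \<open>P = {}\<close> by auto
      then show ?thesis
        using c by (simp add: good_def)
    qed
  qed (use C \<open>z \<in> C\<close> in auto)
  then show "norm (f z) \<le> B + e"
    by (simp add: b_def)
qed

text \<open>The N-th root trick again. The factors of \<open>p\<close> carry a division by 2 so that
  \<open>f ^ N * p\<close> is still bounded by 1 on the disk. At a point of \<open>X\<close> this
  product has radial limit 0, so it has radial control there as well.\<close>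

lemma maximum_modulus_radial_finite_exceptions:
  assumes hol: "f holomorphic_on ball 0 1"
    and bd: "\<And>w. w \<in> ball 0 1 \<Longrightarrow> norm (f w) \<le> 1"
    and C: "open C" "C \<subseteq> ball 0 1"
    and X: "finite X" "X \<subseteq> sphere 0 1"
    and fr: "\<And>w. w \<in> frontier C \<inter> ball 0 1 \<Longrightarrow> norm (f w) \<le> B"
    and rad: "\<And>\<alpha> c. \<alpha> \<in> frontier C \<inter> sphere 0 1 - X \<Longrightarrow> B < c \<Longrightarrow>
               \<forall>\<^sub>F r in at_left 1. norm (f (of_real r * \<alpha>)) \<le> c"
    and "0 \<le> B" and "z \<in> C"
  shows "norm (f z) \<le> B"
proof (rule field_le_epsilon)
  fix e :: real assume "0 < e"
  define c where "c = B + e"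
  have c: "0 < c" "B < c"
    using \<open>0 \<le> B\<close> \<open>0 < e\<close> by (auto simp: c_def)
  define p where "p = (\<lambda>w. \<Prod>x\<in>X. (w - x) / 2)"
  have p1: "norm (p w) \<le> 1" if "norm w \<le> 1" for w
  proof -
    have "norm (w - x) \<le> 2" if "x \<in> X" for x
      using norm_triangle_ineq4[of w x] \<open>norm w \<le> 1\<close> that X by force
    then show ?thesis
      unfolding p_def prod_norm[symmetric] by (intro prod_le_1) (auto simp: norm_divide)
  qed
  have "z \<notin> X"
    using X C \<open>z \<in> C\<close> by force
  then have pz: "0 < norm (p z)"
    using X by (auto simp: p_def)
  have in_ball: "\<forall>\<^sub>F r in at_left (1::real). of_real r * \<alpha> \<in> ball 0 1" if "norm \<alpha> = 1" for \<alpha> :: complex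
    using eventually_at_left_real[of 0 1] by (rule eventually_mono) (auto simp: norm_mult that)
  have "norm (f z) ^ N * norm (p z) \<le> c ^ N * 1" for N
  proof -
    have "norm (f z ^ N * p z) \<le> c ^ N"
    proof (rule maximum_modulus_radial[of "\<lambda>w. f w ^ N * p w" C])
      show "(\<lambda>w. f w ^ N * p w) holomorphic_on ball 0 1"
        unfolding p_def by (intro holomorphic_intros hol) auto
      show "norm (f w ^ N * p w) \<le> 1" if "w \<in> ball 0 1" for w
        using bd[OF that] p1[of w] that by (auto simp: norm_mult norm_power intro!: mult_le_one power_le_one)
      have small: "norm (f w ^ N * p w) \<le> c ^ N" if "norm w < 1" "norm (f w) \<le> c" for w
      proof -
        have "norm (f w ^ N * p w) \<le> c ^ N * 1"
          unfolding norm_mult norm_power using that p1[of w] c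
          by (intro mult_mono power_mono) auto
        then show ?thesis by simp
      qed
      show "norm (f w ^ N * p w) \<le> c ^ N" if "w \<in> frontier C \<inter> ball 0 1" for w
        using fr[OF that] that c by (intro small) auto
      fix \<alpha> c' assume \<alpha>: "\<alpha> \<in> frontier C \<inter> sphere 0 1" and c': "c ^ N < c'"
      show "\<forall>\<^sub>F r in at_left 1. norm (f (of_real r * \<alpha>) ^ N * p (of_real r * \<alpha>)) \<le> c'"
      proof (cases "\<alpha> \<in> X")
        case False
        with \<alpha> have "\<forall>\<^sub>F r in at_left 1. norm (f (of_real r * \<alpha>)) \<le> c"
          using rad c by auto
        moreover have "\<forall>\<^sub>F r in at_left (1::real). of_real r * \<alpha> \<in> ball 0 1"
          using in_ball \<alpha> by simp
        ultimately show ?thesis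
          by eventually_elim (use small c' in force)
      next
        case True
        have "((\<lambda>r. p (of_real r * \<alpha>)) \<longlongrightarrow> p (of_real 1 * \<alpha>)) (at_left 1)"
          unfolding p_def by (intro tendsto_intros) auto
        moreover have "p (of_real 1 * \<alpha>) = 0"
          using True X by (auto simp: p_def)
        moreover have "0 < c ^ N"
          using c by simp
        ultimately have "\<forall>\<^sub>F r in at_left 1. dist (p (of_real r * \<alpha>)) 0 < c ^ N"
          by (metis tendstoD)
        moreover have "\<forall>\<^sub>F r in at_left (1::real). of_real r * \<alpha> \<in> ball 0 1"
          using in_ball \<alpha> by simp
        ultimately show ?thesis
        proof eventually_elim
          case (elim r)
          have "norm (f (of_real r * \<alpha>) ^ N * p (of_real r * \<alpha>)) \<le> 1 * norm (p (of_real r * \<alpha>))"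
            unfolding norm_mult[of "_ ^ N"] norm_power using bd[OF elim(2)]
            by (intro mult_right_mono power_le_one) auto
          then show ?case
            using c' elim by simp
        qed
      qed
    qed (use C c \<open>z \<in> C\<close> in auto)
    then show ?thesis
      by (simp add: norm_mult norm_power)
  qed
  from le_of_power_mult_le[OF this pz c(1)] show "norm (f z) \<le> B + e"
    by (simp add: c_def)
qed

section \<open>The reflection estimate\<close>

text \<open>A form of the Fashoda meet theorem, transported to \<open>real^2\<close>. The enclosing
  box has its bottom edge on the real axis, because that theorem wants the interlaced end points on
  the bottom edge.\<close>

lemma interlaced_half_plane_paths_meet:
  assumes g: "path g" "path_image g \<subseteq> {w. 0 \<le> Im w}"
    and s: "path s" "path_image s \<subseteq> {w. 0 \<le> Im w}"
    and "pathstart g = of_real b" "pathfinish g = of_real c"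
    and "pathstart s = of_real z" "pathfinish s = of_real x"
    and "b < z" "z < c" "c < x"
  obtains w where "w \<in> path_image g" "w \<in> path_image s"
proof -
  define T :: "complex \<Rightarrow> real^2" where "T = (\<lambda>w. \<chi> i. if i = 1 then Re w else Im w)"
  have T1 [simp]: "T w $ 1 = Re w" and T2 [simp]: "T w $ 2 = Im w" for w
    by (simp_all add: T_def)
  have contT: "continuous_on A T" for A
    unfolding T_def
  proof (rule continuous_on_vec_lambda)
    show "continuous_on A (\<lambda>w. if i = 1 then Re w else Im w)" for i :: 2
      by (cases "i = 1") (auto intro!: continuous_intros)
  qed
  have injT: "T v = T w \<Longrightarrow> v = w" for v w
    by (metis T1 T2 complex_eqI)
  obtain M where M: "\<And>w. w \<in> path_image g \<union> path_image s \<Longrightarrow> norm w \<le> M"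
    by (metis bounded_Un bounded_iff bounded_path_image g(1) s(1))
  define lo hi :: "real^2" where "lo = vector [- M, 0]" and "hi = vector [M, M]"
  have box: "T w \<in> cbox lo hi" if "w \<in> path_image g \<union> path_image s" for w
    using M[OF that] that g s abs_Re_le_cmod[of w] abs_Im_le_cmod[of w]
    by (auto simp: mem_box_cart forall_2 lo_def hi_def)
  have "\<exists>y. y \<in> path_image (T \<circ> g) \<and> y \<in> path_image (T \<circ> s)"
  proof (rule fashoda_interlace[of "T \<circ> g" "T \<circ> s" lo hi])
    show "path (T \<circ> g)" "path (T \<circ> s)"
      using g s contT by (auto intro: path_continuous_image)
    show "path_image (T \<circ> g) \<subseteq> cbox lo hi" "path_image (T \<circ> s) \<subseteq> cbox lo hi"
      using box by (auto simp: path_image_compose)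
  qed (use assms in \<open>auto simp: pathstart_compose pathfinish_compose lo_def\<close>)
  then show thesis
    using that injT by (fastforce simp: path_image_compose)
qed

text \<open>If the component left the disk, it would contain a path from \<open>z\<close> to 2,
  because the complement of the closed disk is connected and misses both curves. Folding this path
  and \<open>g\<close> into the upper half plane gives end points \<open>b < z < c < 2\<close>, so
  the folded paths meet. Points with equal folds are equal or conjugate, hence the path would hit
  \<open>g\<close> or its mirror image.\<close>

lemma symmetric_path_component_subset_ball:
  assumes g: "path g" "path_image g \<subseteq> cball 0 1"
    and ends: "pathstart g = of_real b" "pathfinish g = of_real c" "b < z" "z < c"
    and z: "of_real z \<notin> path_image g \<union> cnj ` path_image g"
  shows "connected_component_set (- (path_image g \<union> cnj ` path_image g)) (of_real z) \<subseteq> ball 0 1"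
    (is "?C \<subseteq> _")
proof
  define S where "S = path_image g \<union> cnj ` path_image g"
  have "compact S"
    unfolding S_def using g
    by (intro compact_Un compact_path_image compact_continuous_image continuous_intros) auto
  have "open ?C"
    using \<open>compact S\<close> unfolding S_def
    by (intro open_connected_component open_Compl compact_imp_closed)
  fix w assume w: "w \<in> ?C"
  show "w \<in> ball 0 1"
  proof (rule ccontr)
    assume "w \<notin> ball 0 1"
    then have nw: "1 \<le> norm w"
      by simp
    obtain e where e: "0 < e" "ball w e \<subseteq> ?C"
      using w \<open>open ?C\<close> open_contains_ball by blast
    \<comment> \<open>\<open>w\<close> may lie on the circle itself; a push outwards within the open
      component gives a point strictly outside the closed disk.\<close>
    define w' where "w' = w + (e / 2 / norm w) *\<^sub>R w"
    have "w' \<in> ball w e"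
      using e nw by (auto simp: w'_def dist_norm)
    then have w': "w' \<in> ?C"
      using e by auto
    have "w' = (1 + e / 2 / norm w) *\<^sub>R w"
      by (simp add: w'_def algebra_simps)
    then have "norm w' = (1 + e / 2 / norm w) * norm w"
      using e nw by (simp add: add_nonneg_nonneg)
    then have nw': "1 < norm w'"
      using e nw by (auto simp: distrib_right)
    have "connected (- cball 0 1 :: complex set)"
      by (intro connected_complement_bounded_convex) auto
    moreover have "- cball 0 1 \<subseteq> - S"
      using g by (auto simp: S_def)
    ultimately have "connected_component (- S) w' 2"
      using nw' by (intro connected_componentI[of "- cball 0 1"]) auto
    then have "2 \<in> ?C"
      using w' unfolding S_def[symmetric] by (metis connected_component_trans mem_Collect_eq)
    moreover have "of_real z \<in> ?C"
      using z by simp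
    moreover have "path_connected ?C"
      using \<open>open ?C\<close> by (simp add: connected_open_path_connected)
    ultimately obtain s where s: "path s" "path_image s \<subseteq> ?C" "pathstart s = of_real z" "pathfinish s = 2"
      unfolding path_connected_def by blast
    define fold where "fold = (\<lambda>w. Complex (Re w) \<bar>Im w\<bar>)"
    have contfold: "continuous_on A fold" for A
      unfolding fold_def Complex_eq by (intro continuous_intros)
    have "c \<le> 1"
      using g(2) ends(2) pathfinish_in_path_image[of g] by force
    have "\<exists>y. y \<in> path_image (fold \<circ> g) \<and> y \<in> path_image (fold \<circ> s)"
    proof (rule interlaced_half_plane_paths_meet[of "fold \<circ> g" "fold \<circ> s" b c z 2])
      show "path (fold \<circ> g)" "path (fold \<circ> s)"
        using g s contfold by (auto intro: path_continuous_image)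
    qed (use ends s \<open>c \<le> 1\<close> in \<open>auto simp: path_image_compose pathstart_compose pathfinish_compose fold_def complex_eq_iff\<close>)
    then obtain u v where uv: "u \<in> path_image g" "v \<in> path_image s" "fold u = fold v"
      by (auto simp: path_image_compose)
    then have "v = u \<or> v = cnj u"
      by (auto simp: fold_def complex_eq_iff abs_if split: if_splits)
    moreover have "v \<notin> S"
      using uv(2) s(2) connected_component_subset[of "- S" "of_real z"] unfolding S_def by blast
    ultimately show False
      using uv by (auto simp: S_def)
  qed
qed

lemma reflection_estimate_aux:
  assumes hol: "f holomorphic_on ball 0 1"
    and bd: "\<And>w. w \<in> ball 0 1 \<Longrightarrow> norm (f w) \<le> 1"
    and g: "path g" "path_image g \<subseteq> cball 0 1"
    and ends: "pathstart g = of_real b" "pathfinish g = of_real c" "b < z" "z < c"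
    and X: "finite X" "X \<subseteq> sphere 0 1"
    and small: "\<And>w. w \<in> path_image g \<inter> ball 0 1 \<Longrightarrow> norm (f w) \<le> B"
    and rad: "\<And>\<alpha> c. \<alpha> \<in> path_image g \<inter> sphere 0 1 - X \<Longrightarrow> B < c \<Longrightarrow>
               \<forall>\<^sub>F r in at_left 1. norm (f (of_real r * \<alpha>)) \<le> c"
    and "0 \<le> B"
  shows "(norm (f (of_real z)))\<^sup>2 \<le> B"
proof -
  have "\<bar>b\<bar> \<le> 1" "\<bar>c\<bar> \<le> 1"
    using g(2) ends pathstart_in_path_image[of g] pathfinish_in_path_image[of g] by force+
  then have zb: "of_real z \<in> ball (0::complex) 1"
    using ends by auto
  define K where "K = path_image g"
  show ?thesis
  proof (cases "of_real z \<in> K \<union> cnj ` K")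
    case True
    then have "of_real z \<in> K"
      by (metis UnE complex_cnj_cnj complex_cnj_complex_of_real imageE)
    then have "norm (f (of_real z)) * norm (f (of_real z)) \<le> 1 * B"
      using zb bd small by (intro mult_mono) (auto simp: K_def)
    then show ?thesis
      by (simp add: power2_eq_square)
  next
    case False
    define C where "C = connected_component_set (- (K \<union> cnj ` K)) (of_real z)"
    have "compact (K \<union> cnj ` K)"
      unfolding K_def using g
      by (intro compact_Un compact_path_image compact_continuous_image continuous_intros) auto
    then have clS: "closed (K \<union> cnj ` K)"
      by (rule compact_imp_closed)
    have "open C"
      unfolding C_def by (intro open_connected_component open_Compl clS)
    have Cb: "C \<subseteq> ball 0 1"
      using symmetric_path_component_subset_ball[OF g ends] False by (simp add: C_def K_def)
    have frC: "frontier C \<subseteq> K \<union> cnj ` K"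
      unfolding C_def using frontier_of_connected_component_subset clS
      by (metis frontier_complement frontier_subset_closed subset_trans)
    \<comment> \<open>\<open>F\<close> is small on the whole symmetric set, which encloses \<open>z\<close>, and equals \<open>\<bar>f\<bar>\<^sup>2\<close> at \<open>z\<close>.\<close>
    define F where "F = (\<lambda>w. f w * cnj (f (cnj w)))"
    have "norm (F (of_real z)) \<le> B"
    \<comment> \<open>The exceptional set is symmetrised because radial control at a frontier point
      comes either from that point or from its conjugate.\<close>
    proof (rule maximum_modulus_radial_finite_exceptions[of F C "X \<union> cnj ` X"])
      have "cnj \<circ> f \<circ> cnj holomorphic_on ball 0 1"
        using hol by (intro holomorphic_on_compose_cnj_cnj) (auto simp: image_iff elim!: holomorphic_on_subset)
      then show "F holomorphic_on ball 0 1"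
        unfolding F_def by (intro holomorphic_intros hol) (simp add: o_def)
      have le1: "norm (F w) \<le> norm (f w)" "norm (F w) \<le> norm (f (cnj w))" if "norm w < 1" for w
        using bd[of w] bd[of "cnj w"] that mult_left_le[of "norm (f (cnj w))" "norm (f w)"]
          mult_left_le_one_le[of "norm (f (cnj w))" "norm (f w)"]
        by (auto simp: F_def norm_mult)
      show "norm (F w) \<le> 1" if "w \<in> ball 0 1" for w
        using le1[of w] bd[OF that] that by simp
      show "norm (F w) \<le> B" if "w \<in> frontier C \<inter> ball 0 1" for w
      proof -
        have "w \<in> K \<or> cnj w \<in> K"
          using that frC by auto
        then show ?thesis
          using le1[of w] small[of w] small[of "cnj w"] that by (auto simp: K_def)
      qed
      show "\<forall>\<^sub>F r in at_left 1. norm (F (of_real r * \<alpha>)) \<le> c"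
        if \<alpha>: "\<alpha> \<in> frontier C \<inter> sphere 0 1 - (X \<union> cnj ` X)" and c: "B < c" for \<alpha> c
      proof -
        have ev: "\<forall>\<^sub>F r in at_left (1::real). norm (of_real r * \<alpha>) < 1"
          using eventually_at_left_real[of 0 1] by (rule eventually_mono) (use \<alpha> in \<open>auto simp: norm_mult\<close>)
        consider "\<alpha> \<in> K" | "cnj \<alpha> \<in> K"
          using \<alpha> frC by auto
        then show ?thesis
        proof cases
          case 1
          then have "\<forall>\<^sub>F r in at_left 1. norm (f (of_real r * \<alpha>)) \<le> c"
            using \<alpha> c by (intro rad) (auto simp: K_def)
          with ev show ?thesis
            by eventually_elim (use le1 in force)
        next
          case 2
          have "cnj \<alpha> \<notin> X"
            using \<alpha> by (metis DiffD2 UnCI complex_cnj_cnj image_eqI)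
          then have "\<forall>\<^sub>F r in at_left 1. norm (f (of_real r * cnj \<alpha>)) \<le> c"
            using \<alpha> c 2 by (intro rad) (auto simp: K_def)
          with ev show ?thesis
            by eventually_elim (use le1 in force)
        qed
      qed
      show "of_real z \<in> C"
        using False by (simp add: C_def)
    qed (use X \<open>open C\<close> Cb \<open>0 \<le> B\<close> in auto)
    then show ?thesis
      by (simp add: F_def norm_mult power2_eq_square)
  qed
qed

lemma reflection_estimate:
  assumes hol: "f holomorphic_on ball 0 1"
    and bd: "\<And>w. w \<in> ball 0 1 \<Longrightarrow> norm (f w) \<le> 1"
    and g: "path g" "path_image g \<subseteq> cball 0 1"
    and ends: "pathstart g = of_real b" "pathfinish g = of_real c" and z: "z \<in> open_segment b c"
    and X: "finite X" "X \<subseteq> sphere 0 1"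
    and small: "\<And>w. w \<in> path_image g \<inter> ball 0 1 \<Longrightarrow> norm (f w) \<le> B"
    and rad: "\<And>\<alpha> c. \<alpha> \<in> path_image g \<inter> sphere 0 1 - X \<Longrightarrow> B < c \<Longrightarrow>
               \<forall>\<^sub>F r in at_left 1. norm (f (of_real r * \<alpha>)) \<le> c"
    and "0 \<le> B"
  shows "(norm (f (of_real z)))\<^sup>2 \<le> B"
proof (cases "b < c")
  case True
  then show ?thesis
    using reflection_estimate_aux[OF hol bd g ends _ _ X small rad \<open>0 \<le> B\<close>] z
    by (simp add: open_segment_eq_real_ivl)
next
  case False
  then show ?thesis
    using reflection_estimate_aux[of f "reversepath g" c b z X B] assms
    by (simp add: open_segment_eq_real_ivl split: if_splits)
qed

section \<open>Theorems of Lindelof and Koebe\<close>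

lemma norm_mult_exp_le:
  fixes w :: complex
  assumes "norm w \<le> 1" "0 \<le> k"
  shows "norm (v * exp (of_real k * (w - 1))) \<le> norm v"
proof -
  have "k * (Re w - 1) \<le> 0"
    using assms complex_Re_le_cmod[of w] by (intro mult_nonneg_nonpos) auto
  then show ?thesis
    by (simp add: norm_mult mult_left_le)
qed

text \<open>Brings the end of a path to the real diameter, as the reflection estimate demands. Since
  the real part is constant on the segment, so is the modulus of the peak function
  \<open>exp (k * (w - 1))\<close>.\<close>

lemma vertical_segment_in_ball:
  assumes "w \<in> closed_segment x (of_real (Re x))" "norm x < 1"
  shows "norm w < 1" "Re w = Re x"
proof -
  have r: "norm (of_real (Re x) :: complex) < 1"
    using abs_Re_le_cmod[of x] assms by simp
  have "closed_segment x (of_real (Re x)) \<subseteq> ball 0 1"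
    using assms r by (intro closed_segment_subset) auto
  then show "norm w < 1"
    using assms by auto
  obtain u where "w = (1 - u) *\<^sub>R x + u *\<^sub>R of_real (Re x)"
    using assms by (auto simp: in_segment)
  then have "Re w = (1 - u) * Re x + u * Re x"
    by simp
  then show "Re w = Re x"
    by (simp add: algebra_simps)
qed

text \<open>The path is followed from 1 only as long as \<open>f\<close> is small and is then
  dropped vertically to the real axis. On the vertical segment only the bound 1 is known for
  \<open>f\<close>, but a steep peak function at 1 makes \<open>F\<close> small there. The
  reflection estimate bounds \<open>F\<close> on the radius near 1, where the peak function is close
  to 1.\<close>

lemma Lindelof_at_1:
  assumes hol: "f holomorphic_on ball 0 1"
    and bd: "\<And>w. w \<in> ball 0 1 \<Longrightarrow> norm (f w) \<le> 1"
    and \<kappa>: "path \<kappa>" "\<kappa> 0 = 1" "\<kappa> ` {0<..1} \<subseteq> ball 0 1"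
    and lim: "((\<lambda>t. f (\<kappa> t)) \<longlongrightarrow> 0) (at_right 0)"
  shows "((\<lambda>r. f (of_real r)) \<longlongrightarrow> 0) (at_left (1::real))"
proof (rule tendstoI)
  fix e :: real assume "0 < e"
  \<comment> \<open>The estimate bounds a square by \<open>B\<close>, and undoing the squared peak
    function costs a factor below 2 near 1; what is used at the end is
    \<open>2 * B < e\<^sup>2\<close>.\<close>
  define B where "B = e\<^sup>2 / 4"
  have "0 < B"
    using \<open>0 < e\<close> by (simp add: B_def)
  have "\<forall>\<^sub>F t in at_right 0. norm (f (\<kappa> t)) < B"
    using tendstoD[OF lim \<open>0 < B\<close>] by simp
  then obtain t0 where t0: "0 < t0" "\<And>t. 0 < t \<Longrightarrow> t < t0 \<Longrightarrow> norm (f (\<kappa> t)) < B"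
    unfolding eventually_at_right_field by blast
  define t1 where "t1 = min 1 (t0 / 2)"
  have t1: "0 < t1" "t1 \<le> 1" "t1 < t0"
    using t0 by (auto simp: t1_def)
  define x where "x = \<kappa> t1"
  have nx: "norm x < 1"
    using \<kappa>(3) t1 by (force simp: x_def)
  define a where "a = Re x"
  have "a < 1"
    using nx complex_Re_le_cmod[of x] by (simp add: a_def)
  obtain k where k: "0 \<le> k" "exp (- (k * (1 - a))) \<le> B"
    using exp_neg_le_ex[OF \<open>0 < B\<close>, of "1 - a"] \<open>a < 1\<close> by auto
  define F where "F = (\<lambda>w. f w * exp (of_real k * (w - 1)))"
  define g where "g = subpath 0 t1 \<kappa> +++ linepath x (of_real a)"
  have img: "path_image g = \<kappa> ` {0..t1} \<union> closed_segment x (of_real a)"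
    unfolding g_def using t1 by (subst path_image_join) (auto simp: path_image_subpath x_def)
  have img_cases: "w = 1 \<or> norm w < 1 \<and> norm (F w) \<le> B" if wg: "w \<in> path_image g" for w
  proof -
    consider t where "w = \<kappa> t" "0 \<le> t" "t \<le> t1" | "w \<in> closed_segment x (of_real a)"
      using wg unfolding img by force
    then show ?thesis
    proof cases
      case 1
      show ?thesis
      proof (cases "t = 0")
        case False
        then have "norm w < 1" "norm (f w) < B"
          using 1 t1 t0(2)[of t] \<kappa>(3) by force+
        then show ?thesis
          using norm_mult_exp_le[of w k "f w"] k(1) by (simp add: F_def)
      qed (use 1 \<kappa> in simp)
    next
      case 2
      then have w: "norm w < 1" "Re w = a"
        using vertical_segment_in_ball[of w x] nx unfolding a_def by blast+
      have "norm (F w) \<le> 1 * exp (- (k * (1 - a)))"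
        unfolding F_def norm_mult using bd[of w] w
        by (intro mult_mono) (auto simp: algebra_simps)
      then show ?thesis
        using w k by simp
    qed
  qed
  have sq: "(norm (F (of_real r)))\<^sup>2 \<le> B" if r: "a < r" "r < 1" for r
  \<comment> \<open>The path meets the circle at 1 only, and the radial behaviour there is what is
    to be proved, so 1 is declared exceptional.\<close>
  proof (rule reflection_estimate[of F g 1 a r "{1}" B])
    show "F holomorphic_on ball 0 1"
      unfolding F_def by (intro holomorphic_intros hol)
    show "norm (F w) \<le> 1" if "w \<in> ball 0 1" for w
      using norm_mult_exp_le[of w k "f w"] bd[OF that] k that by (simp add: F_def)
    show "path g"
      unfolding g_def using \<kappa> t1 by (intro path_join_imp path_subpath) (auto simp: x_def)
    show "path_image g \<subseteq> cball 0 1"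
      using img_cases by force
    show "pathstart g = of_real 1" "pathfinish g = of_real a"
      using \<kappa> by (auto simp: g_def)
    show "r \<in> open_segment 1 a"
      using r by (simp add: open_segment_eq_real_ivl)
    show "norm (F w) \<le> B" if "w \<in> path_image g \<inter> ball 0 1" for w
      using img_cases[of w] that by auto
    show "\<forall>\<^sub>F r in at_left 1. norm (F (of_real r * \<alpha>)) \<le> c"
      if "\<alpha> \<in> path_image g \<inter> sphere 0 1 - {1}" for \<alpha> c
      using img_cases[of \<alpha>] that by auto
  qed (use \<open>0 < B\<close> in auto)
  have "((\<lambda>r. exp (2 * k * (1 - r))) \<longlongrightarrow> exp (2 * k * (1 - 1))) (at_left 1)"
    by (intro tendsto_intros)
  then have "\<forall>\<^sub>F r in at_left 1. exp (2 * k * (1 - r)) < 2"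
    by (rule order_tendstoD(2)) simp
  moreover have "\<forall>\<^sub>F r in at_left 1. r \<in> {a<..<1}"
    using \<open>a < 1\<close> by (rule eventually_at_left_real)
  ultimately show "\<forall>\<^sub>F r in at_left 1. dist (f (of_real r)) 0 < e"
  proof eventually_elim
    case (elim r)
    have "norm (F (of_real r)) = norm (f (of_real r)) * exp (- (k * (1 - r)))"
      by (simp add: F_def norm_mult algebra_simps)
    then have "(norm (f (of_real r)) * exp (- (k * (1 - r))))\<^sup>2 \<le> B"
      using sq[of r] elim by simp
    then have "(norm (f (of_real r)) * exp (- (k * (1 - r))))\<^sup>2 * exp (2 * k * (1 - r)) \<le> B * 2"
      using elim \<open>0 < B\<close> by (intro mult_mono) auto
    also have "(norm (f (of_real r)) * exp (- (k * (1 - r))))\<^sup>2 * exp (2 * k * (1 - r))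
        = (norm (f (of_real r)))\<^sup>2 * (exp (- (2 * k * (1 - r))) * exp (2 * k * (1 - r)))"
      by (simp add: power_mult_distrib algebra_simps flip: exp_double)
    also have "\<dots> = (norm (f (of_real r)))\<^sup>2"
      by (simp flip: exp_add)
    also have "B * 2 < e\<^sup>2"
      using \<open>0 < e\<close> by (simp add: B_def)
    finally show ?case
      using \<open>0 < e\<close> by (simp add: power_less_imp_less_base)
  qed
qed

text \<open>With the smallness \<open>exp (- (k * (1 - \<rho>)))\<close> on \<open>W\<close>, the
  reflection estimate for \<open>f\<close> times a peak function gives at real \<open>r\<close> a
  bound that tends to 0 as \<open>k\<close> grows, provided \<open>2 * (1 - r) < 1 - \<rho>\<close>.
  So \<open>f\<close> vanishes on a real interval ending at 1, and the identity theorem finishes.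
  Each \<open>k\<close> may use its own \<open>W\<close>.\<close>

lemma Koebe_at_1:
  assumes hol: "f holomorphic_on ball 0 1"
    and bd: "\<And>w. w \<in> ball 0 1 \<Longrightarrow> norm (f w) \<le> 1"
    and "Re \<beta> < 1"
    and W: "\<And>e. 0 < e \<Longrightarrow> \<exists>W. path_connected W \<and> W \<subseteq> ball 0 1 \<and> 1 \<in> closure W \<and> \<beta> \<in> closure W
              \<and> (\<forall>w\<in>W. norm (f w) \<le> e)"
    and "w \<in> ball 0 1"
  shows "f w = 0"
proof -
  obtain \<rho>' where \<rho>': "Re \<beta> < \<rho>'" "\<rho>' < 1"
    using \<open>Re \<beta> < 1\<close> dense by blast
  \<comment> \<open>The maximum with 0 keeps the real interval from \<open>\<rho>\<close> to 1
    inside the disk, since \<open>Re \<beta>\<close> is not bounded below here.\<close>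
  define \<rho> where "\<rho> = max 0 \<rho>'"
  have \<rho>: "Re \<beta> < \<rho>" "\<rho> < 1" "0 \<le> \<rho>"
    using \<rho>' by (auto simp: \<rho>_def)
  have sq: "(norm (f (of_real r)))\<^sup>2 * ((1 - r)\<^sup>2 / 4) \<le> exp (- (k * ((1 - \<rho>) - 2 * (1 - r))))"
    if r: "\<rho> < r" "r < 1" and "0 \<le> k" for r k
  proof -
    define B where "B = exp (- (k * (1 - \<rho>)))"
    have "0 < B"
      by (simp add: B_def)
    obtain W where W: "path_connected W" "W \<subseteq> ball 0 1" "1 \<in> closure W" "\<beta> \<in> closure W"
      "\<And>w. w \<in> W \<Longrightarrow> norm (f w) \<le> B"
      using assms(4)[OF \<open>0 < B\<close>] by blast
    obtain a where a: "a \<in> W" "dist a 1 < min B (1 - r)"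
      using W(3) \<open>0 < B\<close> r unfolding closure_approachable by (metis diff_gt_0_iff_gt min_less_iff_conj)
    obtain a' where a': "a' \<in> W" "dist a' \<beta> < \<rho> - Re \<beta>"
      using W(4) \<rho> unfolding closure_approachable by (metis diff_gt_0_iff_gt)
    have Rea: "r < Re a"
      using a abs_Re_le_cmod[of "a - 1"] by (simp add: dist_norm abs_le_iff)
    have Rea': "Re a' < \<rho>"
      using a' abs_Re_le_cmod[of "a' - \<beta>"] by (simp add: dist_norm abs_le_iff)
    have na: "norm a < 1" "norm a' < 1"
      using a a' W(2) by auto
    obtain p where p: "path p" "path_image p \<subseteq> W" "pathstart p = a" "pathfinish p = a'"
      using W(1) a a' unfolding path_connected_def by blast
    define g where "g = linepath (of_real (Re a)) a +++ p +++ linepath a' (of_real (Re a'))"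
    have img: "path_image g = closed_segment a (of_real (Re a)) \<union> path_image p \<union> closed_segment a' (of_real (Re a'))"
      unfolding g_def using p
      by (simp add: path_image_join Un_assoc closed_segment_commute)
    \<comment> \<open>One factor for each of the three pieces of \<open>g\<close>: \<open>f\<close>
      is at most \<open>B\<close> on \<open>p\<close>; the exponential is at most \<open>B\<close>
      on the segment at \<open>a'\<close>, whose real part is below \<open>\<rho>\<close>; and
      \<open>(w - 1) / 2\<close> is at most \<open>B\<close> on the segment at \<open>a\<close>,
      which lies within \<open>B\<close> of 1.\<close>
    define F where "F = (\<lambda>w. f w * exp (of_real k * (w - 1)) * ((w - 1) / 2))"
    have half: "norm ((w - 1) / 2) \<le> 1" if "norm w \<le> 1" for w :: complex
      using norm_triangle_ineq4[of w 1] that by (simp add: norm_divide)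
    have Ff: "norm (F w) \<le> norm (f w)" if "norm w < 1" for w
    proof -
      have "norm (F w) \<le> norm (f w * exp (of_real k * (w - 1))) * 1"
        unfolding F_def norm_mult[of _ "(w - 1) / 2"] using half[of w] that
        by (intro mult_left_mono) auto
      then show ?thesis
        using norm_mult_exp_le[of w k "f w"] \<open>0 \<le> k\<close> that by simp
    qed
    have img_small: "norm w < 1 \<and> norm (F w) \<le> B" if wg: "w \<in> path_image g" for w
    proof -
      consider "w \<in> closed_segment a (of_real (Re a))" | "w \<in> path_image p"
        | "w \<in> closed_segment a' (of_real (Re a'))"
        using wg unfolding img by blast
      then show ?thesis
      proof cases
        case 1
        then have nw: "norm w < 1"
          using vertical_segment_in_ball na by blast
        have "dist (of_real (Re a)) (1::complex) = \<bar>Re a - 1\<bar>"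
          by (metis dist_of_real dist_real_def of_real_1)
        then have "dist (of_real (Re a)) (1::complex) \<le> dist a 1"
          using abs_Re_le_cmod[of "a - 1"] by (simp add: dist_norm)
        then have "closed_segment a (of_real (Re a)) \<subseteq> ball 1 B"
          using a by (intro closed_segment_subset) (auto simp: dist_commute)
        then have "norm (w - 1) < B"
          using 1 by (auto simp: dist_norm norm_minus_commute)
        moreover have "norm (F w) \<le> 1 * (norm (w - 1) / 2)"
          unfolding F_def norm_mult[of _ "(w - 1) / 2"] using nw bd[of w]
            norm_mult_exp_le[of w k "f w"] \<open>0 \<le> k\<close>
          by (intro mult_mono) (auto simp: norm_divide)
        ultimately show ?thesis
          using nw \<open>0 < B\<close> by simp
      next
        case 2
        then have "w \<in> W"
          using p by blast
        then have "norm w < 1" "norm (f w) \<le> B"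
          using W by auto
        then show ?thesis
          using Ff[of w] by simp
      next
        case 3
        then have w: "norm w < 1" "Re w = Re a'"
          using vertical_segment_in_ball na by blast+
        have "norm (F w) \<le> norm (f w) * exp (k * (Re w - 1)) * 1"
          unfolding F_def norm_mult using half[of w] w
          by (intro mult_mono) auto
        also have "\<dots> \<le> 1 * exp (k * (Re w - 1)) * 1"
          using bd[of w] w by (intro mult_right_mono) auto
        also have "\<dots> \<le> B"
          using w Rea' \<open>0 \<le> k\<close> mult_left_mono[of "Re w - 1" "\<rho> - 1" k]
          by (simp add: B_def algebra_simps)
        finally show ?thesis
          using w by simp
      qed
    qed
    have "(norm (F (of_real r)))\<^sup>2 \<le> B"
    proof (rule reflection_estimate[of F g "Re a" "Re a'" r "{}" B])
      show "F holomorphic_on ball 0 1"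
        unfolding F_def by (intro holomorphic_intros hol) auto
      show "norm (F w) \<le> 1" if "w \<in> ball 0 1" for w
        using Ff[of w] bd[OF that] that by simp
      show "path g"
        unfolding g_def using p by (intro path_join_imp) auto
      show "r \<in> open_segment (Re a) (Re a')"
        using Rea Rea' r by (simp add: open_segment_eq_real_ivl)
    qed (use img_small \<open>0 < B\<close> in \<open>force simp: g_def\<close>)+
    moreover have "norm (F (of_real r)) = norm (f (of_real r)) * exp (- (k * (1 - r))) * ((1 - r) / 2)"
    proof -
      have "norm (of_real r - 1 :: complex) = \<bar>r - 1\<bar>"
        by (metis norm_of_real of_real_1 of_real_diff)
      then have "norm ((of_real r - 1) / 2 :: complex) = (1 - r) / 2"
        using r by (simp add: norm_divide)
      moreover have "norm (exp (of_real k * (of_real r - 1 :: complex))) = exp (- (k * (1 - r)))"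
        by (simp add: right_diff_distrib)
      ultimately show ?thesis
        by (simp only: F_def norm_mult)
    qed
    ultimately have "(norm (f (of_real r)) * exp (- (k * (1 - r))) * ((1 - r) / 2))\<^sup>2 * exp (2 * (k * (1 - r)))
        \<le> B * exp (2 * (k * (1 - r)))"
      by (intro mult_right_mono) auto
    also have "B * exp (2 * (k * (1 - r))) = exp (- (k * ((1 - \<rho>) - 2 * (1 - r))))"
      unfolding B_def mult_exp_exp by (simp add: algebra_simps)
    also have "(norm (f (of_real r)) * exp (- (k * (1 - r))) * ((1 - r) / 2))\<^sup>2 * exp (2 * (k * (1 - r)))
        = (norm (f (of_real r)))\<^sup>2 * ((1 - r)\<^sup>2 / 4) * (exp (2 * (- (k * (1 - r)))) * exp (2 * (k * (1 - r))))"
      by (simp only: exp_double power_mult_distrib power_divide) simp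
    also have "\<dots> = (norm (f (of_real r)))\<^sup>2 * ((1 - r)\<^sup>2 / 4)"
      unfolding mult_exp_exp by simp
    finally show ?thesis .
  qed
  have zero: "f (of_real r) = 0" if r: "(1 + \<rho>) / 2 < r" "r < 1" for r
  proof (rule ccontr)
    assume "f (of_real r) \<noteq> 0"
    then have "0 < (norm (f (of_real r)))\<^sup>2 * ((1 - r)\<^sup>2 / 4)" (is "0 < ?q")
      using r by simp
    then have "0 < ?q / 2" by simp
    moreover have "0 < (1 - \<rho>) - 2 * (1 - r)"
      using r by simp
    ultimately obtain k where k: "0 \<le> k" "exp (- (k * ((1 - \<rho>) - 2 * (1 - r)))) \<le> ?q / 2"
      using exp_neg_le_ex by blast
    have "\<rho> < r"
      using r \<rho> by simp
    from sq[OF this r(2) k(1)] k(2) have "?q \<le> ?q / 2"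
      by (rule order_trans)
    with \<open>0 < ?q\<close> show False by simp
  qed
  define U where "U = (of_real ` {(1 + \<rho>) / 2<..<1} :: complex set)"
  define \<xi> where "\<xi> = (1 + (1 + \<rho>) / 2) / 2"
  have \<xi>: "(1 + \<rho>) / 2 < \<xi>" "\<xi> < (\<xi> + 1) / 2" "(\<xi> + 1) / 2 < 1" "\<xi> < 1"
    using \<rho> by (auto simp: \<xi>_def)
  show ?thesis
  proof (rule analytic_continuation[OF hol, of U "of_real \<xi>"])
    have "connected U"
      unfolding U_def by (intro connected_continuous_image continuous_intros) auto
    moreover have "of_real \<xi> \<in> U" "of_real ((\<xi> + 1) / 2) \<in> U"
      using \<xi> unfolding U_def by (intro imageI; simp)+
    moreover have "(of_real \<xi> :: complex) \<noteq> of_real ((\<xi> + 1) / 2)"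
      using \<xi> by (simp only: of_real_eq_iff)
    ultimately show "of_real \<xi> islimpt U"
      by (metis connected_imp_perfect singletonD)
    show "U \<subseteq> ball 0 1" "of_real \<xi> \<in> ball (0::complex) 1"
      using \<rho> \<xi> by (auto simp: U_def)
    show "f x = 0" if "x \<in> U" for x
      using that unfolding U_def by (rule imageE) (use zero in simp)
  qed (use \<open>w \<in> ball 0 1\<close> in auto)
qed

section \<open>Transfer to arbitrary circle points and arbitrary bounds\<close>

lemma rotated_normalization:
  fixes \<phi> :: "complex \<Rightarrow> complex"
  assumes hol: "\<phi> holomorphic_on ball 0 1" and "bounded (\<phi> ` ball 0 1)"
    and "norm u = 1"
  obtains M where "0 < M" "(\<lambda>w. (\<phi> (u * w) - w0) / of_real M) holomorphic_on ball 0 1"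
    "\<And>w. w \<in> ball 0 1 \<Longrightarrow> norm ((\<phi> (u * w) - w0) / of_real M) \<le> 1"
proof -
  have "bounded ((\<lambda>w. \<phi> w - w0) ` ball 0 1)"
    using assms(2) by (rule bounded_minus_comp) (rule bounded_subset[of "{w0}"], auto)
  then obtain M where M: "0 < M" "\<And>w. w \<in> ball 0 1 \<Longrightarrow> norm (\<phi> w - w0) \<le> M"
    unfolding bounded_pos by blast
  have rot: "u * w \<in> ball 0 1" if "w \<in> ball 0 1" for w
    using that \<open>norm u = 1\<close> by (simp add: norm_mult)
  show thesis
  proof
    have "(\<phi> \<circ> (\<lambda>w. u * w)) holomorphic_on ball 0 1"
      using rot by (intro holomorphic_on_compose_gen[OF _ hol] holomorphic_intros) auto
    then show "(\<lambda>w. (\<phi> (u * w) - w0) / of_real M) holomorphic_on ball 0 1"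
      using M by (intro holomorphic_intros) (auto simp: o_def)
    show "norm ((\<phi> (u * w) - w0) / of_real M) \<le> 1" if "w \<in> ball 0 1" for w
      using M rot[OF that] by (simp add: norm_divide)
  qed (use M in auto)
qed

lemma unit_mult_cnj:
  assumes "norm u = 1"
  shows "u * cnj u = 1" "u * (cnj u * w) = w" "cnj u * (u * w) = w"
proof -
  show *: "u * cnj u = 1"
    using assms by (metis complex_norm_square of_real_1 power_one)
  show "u * (cnj u * w) = w" "cnj u * (u * w) = w"
    using * by (simp_all flip: mult.assoc add: mult.commute[of "cnj u"])
qed

proposition Lindelof:
  assumes hol: "\<phi> holomorphic_on ball 0 1" and bd: "bounded (\<phi> ` ball 0 1)"
    and \<kappa>: "path \<kappa>" "\<kappa> 0 = \<alpha>" "norm \<alpha> = 1" "\<kappa> ` {0<..1} \<subseteq> ball 0 1"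
    and lim: "((\<lambda>t. \<phi> (\<kappa> t)) \<longlongrightarrow> w0) (at_right 0)"
  shows "((\<lambda>r. \<phi> (of_real r * \<alpha>)) \<longlongrightarrow> w0) (at_left (1::real))"
proof -
  obtain M where M: "0 < M" "(\<lambda>w. (\<phi> (\<alpha> * w) - w0) / of_real M) holomorphic_on ball 0 1"
    "\<And>w. w \<in> ball 0 1 \<Longrightarrow> norm ((\<phi> (\<alpha> * w) - w0) / of_real M) \<le> 1"
    using rotated_normalization[OF hol bd \<kappa>(3)] by blast
  note u = unit_mult_cnj[OF \<kappa>(3)]
  have "((\<lambda>r. (\<phi> (\<alpha> * of_real r) - w0) / of_real M) \<longlongrightarrow> 0) (at_left (1::real))"
  proof (rule Lindelof_at_1[OF M(2,3), of "\<lambda>t. cnj \<alpha> * \<kappa> t"])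
    show "path (\<lambda>t. cnj \<alpha> * \<kappa> t)"
      using \<kappa>(1) unfolding path_def by (intro continuous_intros)
    show "cnj \<alpha> * \<kappa> 0 = 1"
      using \<kappa> u by (simp add: mult.commute)
    show "(\<lambda>t. cnj \<alpha> * \<kappa> t) ` {0<..1} \<subseteq> ball 0 1"
      using \<kappa> by (auto simp: norm_mult image_subset_iff)
    have "((\<lambda>t. (\<phi> (\<kappa> t) - w0) / of_real M) \<longlongrightarrow> (w0 - w0) / of_real M) (at_right 0)"
      using M(1) by (intro tendsto_intros lim) auto
    then show "((\<lambda>t. (\<phi> (\<alpha> * (cnj \<alpha> * \<kappa> t)) - w0) / of_real M) \<longlongrightarrow> 0) (at_right 0)"
      by (simp add: u)
  qed
  then have "((\<lambda>r. (\<phi> (\<alpha> * of_real r) - w0) / of_real M * of_real M + w0) \<longlongrightarrow> 0 * of_real M + w0) (at_left (1::real))"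
    by (intro tendsto_intros)
  then show ?thesis
    using M(1) by (simp add: mult.commute)
qed

text \<open>The second point \<beta> may also lie inside the disk, because a limit set could join a
  circle point to an interior one. In either case \<open>\<beta> \<noteq> \<alpha>\<close> gives
  \<open>Re (cnj \<alpha> * \<beta>) < 1\<close>, which is all that the normalised version asks
  for.\<close>

proposition Koebe:
  assumes hol: "\<phi> holomorphic_on ball 0 1" and bd: "bounded (\<phi> ` ball 0 1)"
    and \<alpha>: "norm \<alpha> = 1" and \<beta>: "norm \<beta> \<le> 1" "\<beta> \<noteq> \<alpha>"
    and W: "\<And>e. 0 < e \<Longrightarrow> \<exists>W. path_connected W \<and> W \<subseteq> ball 0 1 \<and> \<alpha> \<in> closure W \<and> \<beta> \<in> closure W
              \<and> (\<forall>w\<in>W. dist (\<phi> w) w0 \<le> e)"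
    and "w \<in> ball 0 1"
  shows "\<phi> w = w0"
proof -
  obtain M where M: "0 < M" "(\<lambda>w. (\<phi> (\<alpha> * w) - w0) / of_real M) holomorphic_on ball 0 1"
    "\<And>w. w \<in> ball 0 1 \<Longrightarrow> norm ((\<phi> (\<alpha> * w) - w0) / of_real M) \<le> 1"
    using rotated_normalization[OF hol bd \<alpha>] by blast
  note u = unit_mult_cnj[OF \<alpha>]
  have "(\<phi> (\<alpha> * (cnj \<alpha> * w)) - w0) / of_real M = 0"
  proof (rule Koebe_at_1[OF M(2,3), of "cnj \<alpha> * \<beta>"])
    have "0 < norm (\<beta> - \<alpha>)"
      using \<beta> by simp
    then have "0 < (norm (\<beta> - \<alpha>))\<^sup>2"
      by simp
    then show "Re (cnj \<alpha> * \<beta>) < 1"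
      using Re_mult_cnj_le[OF \<alpha> \<beta>(1)] by (simp only: mult.commute[of "cnj \<alpha>"])
    show "cnj \<alpha> * w \<in> ball 0 1"
      using \<alpha> \<open>w \<in> ball 0 1\<close> by (simp add: norm_mult)
    fix e :: real assume "0 < e"
    then have "0 < e * M"
      using M(1) by simp
    then obtain V where V: "path_connected V" "V \<subseteq> ball 0 1" "\<alpha> \<in> closure V" "\<beta> \<in> closure V"
      "\<And>w. w \<in> V \<Longrightarrow> dist (\<phi> w) w0 \<le> e * M"
      using W by meson
    have clV: "cnj \<alpha> * v \<in> closure ((*) (cnj \<alpha>) ` V)" if "v \<in> closure V" for v
    proof -
      have "(*) (cnj \<alpha>) ` closure V \<subseteq> closure ((*) (cnj \<alpha>) ` V)"
        by (intro image_closure_subset continuous_intros closed_closure closure_subset)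
      then show ?thesis
        using that by blast
    qed
    show "\<exists>W. path_connected W \<and> W \<subseteq> ball 0 1 \<and> 1 \<in> closure W \<and> cnj \<alpha> * \<beta> \<in> closure W
        \<and> (\<forall>w\<in>W. norm ((\<phi> (\<alpha> * w) - w0) / of_real M) \<le> e)"
    proof (intro exI[of _ "(*) (cnj \<alpha>) ` V"] conjI)
      show "path_connected ((*) (cnj \<alpha>) ` V)"
        using V(1) by (intro path_connected_continuous_image continuous_intros)
      show "(*) (cnj \<alpha>) ` V \<subseteq> ball 0 1"
        using V(2) \<alpha> by (auto simp: norm_mult)
      show "1 \<in> closure ((*) (cnj \<alpha>) ` V)"
        using clV[OF V(3)] u(1) by (simp add: mult.commute)
      show "cnj \<alpha> * \<beta> \<in> closure ((*) (cnj \<alpha>) ` V)"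
        by (rule clV[OF V(4)])
      show "\<forall>w\<in>(*) (cnj \<alpha>) ` V. norm ((\<phi> (\<alpha> * w) - w0) / of_real M) \<le> e"
        using V(5) M(1) by (auto simp: u norm_divide dist_norm field_simps)
    qed
  qed
  then show ?thesis
    using M(1) by (simp add: u)
qed

text \<open>The intersection \<open>K\<close> of the closures is a nonempty continuum. If it
  contains a circle point and a further point, Koebe's lemma makes \<open>\<phi>\<close> constant.
  If it lies in the open disk and has two points, it has no isolated points, and
  \<open>\<phi> = w0\<close> on it by continuity, so the identity theorem makes
  \<open>\<phi>\<close> constant. Hence \<open>K\<close> is a single point, and by compactness the
  sets shrink to it.\<close>

proposition nested_sets_shrink_to_point:
  fixes \<phi> :: "complex \<Rightarrow> complex" and W :: "nat \<Rightarrow> complex set"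
  assumes hol: "\<phi> holomorphic_on ball 0 1" and bd: "bounded (\<phi> ` ball 0 1)"
    and nonconst: "v \<in> ball 0 1" "\<phi> v \<noteq> w0"
    and W: "\<And>n. path_connected (W n)" "\<And>n. W n \<noteq> {}" "\<And>n. W n \<subseteq> ball 0 1"
    and decr: "\<And>m n. m \<le> n \<Longrightarrow> W n \<subseteq> W m"
    and lim: "\<And>e. 0 < e \<Longrightarrow> \<exists>n. \<forall>w\<in>W n. dist (\<phi> w) w0 \<le> e"
  obtains z where "z \<in> cball 0 1" "\<And>e. 0 < e \<Longrightarrow> \<exists>n. W n \<subseteq> ball z e"
proof -
  have clW: "closure (W n) \<subseteq> cball 0 1" for n
    using closure_mono[OF W(3)[of n]] by simp
  have cpt: "compact (closure (W n))" for n
    using W(3)[of n] by (simp add: bounded_subset[OF bounded_ball])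
  have decr': "closure (W n) \<subseteq> closure (W m)" if "m \<le> n" for m n
    using decr[OF that] by (rule closure_mono)
  define K where "K = (\<Inter>n. closure (W n))"
  have "K \<noteq> {}"
    unfolding K_def using cpt W(2) decr' by (intro compact_nest) auto
  then obtain z where z: "z \<in> K"
    by blast
  have zc: "z \<in> cball 0 1"
    using z clW unfolding K_def by blast
  have contf: "isCont \<phi> w" if "w \<in> ball 0 1" for w
    using hol that by (metis at_within_open continuous_on_eq_continuous_within
        holomorphic_on_imp_continuous_on open_ball)
  have fK: "\<phi> x = w0" if x: "x \<in> K" "x \<in> ball 0 1" for x
  proof (rule ccontr)
    assume "\<phi> x \<noteq> w0"
    define e where "e = dist (\<phi> x) w0 / 2"
    have "0 < e"
      using \<open>\<phi> x \<noteq> w0\<close> by (simp add: e_def)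
    then obtain n where n: "\<And>w. w \<in> W n \<Longrightarrow> dist (\<phi> w) w0 \<le> e"
      using lim by blast
    obtain d where d: "0 < d" "\<And>y. dist y x < d \<Longrightarrow> dist (\<phi> y) (\<phi> x) < e"
      using contf[OF x(2)] \<open>0 < e\<close> unfolding continuous_at_eps_delta by blast
    have "x \<in> closure (W n)"
      using x by (auto simp: K_def)
    then obtain y where "y \<in> W n" "dist y x < d"
      using d(1) closure_approachable by blast
    then have "dist (\<phi> y) w0 \<le> e" "dist (\<phi> y) (\<phi> x) < e"
      using n d by auto
    then have "dist (\<phi> x) w0 < e + e"
      using dist_triangle[of "\<phi> x" w0 "\<phi> y"] by (simp add: dist_commute)
    then show False
      by (simp add: e_def)
  qed
  have no_sphere: False if x: "x \<in> K" "norm x = 1" and y: "y \<in> K" "y \<noteq> x" for x y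
  proof -
    have "\<phi> v = w0"
    proof (rule Koebe[OF hol bd x(2)])
      show "norm y \<le> 1"
        using y clW unfolding K_def by force
      show "\<exists>W. path_connected W \<and> W \<subseteq> ball 0 1 \<and> x \<in> closure W \<and> y \<in> closure W
              \<and> (\<forall>w\<in>W. dist (\<phi> w) w0 \<le> e)" if e: "0 < e" for e
      proof -
        obtain n where "\<forall>w\<in>W n. dist (\<phi> w) w0 \<le> e"
          using lim[OF e] by blast
        moreover have "x \<in> closure (W n)" "y \<in> closure (W n)"
          using x(1) y(1) by (auto simp: K_def)
        ultimately show ?thesis
          using W by blast
      qed
    qed (use y nonconst in auto)
    with nonconst show False by simp
  qed
  have uniq: "y = z" if y: "y \<in> K" for y
  proof (rule ccontr)
    assume "y \<noteq> z"
    have Kb: "K \<subseteq> ball 0 1"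
    proof
      fix x assume x: "x \<in> K"
      then have "norm x \<le> 1"
        using clW unfolding K_def by force
      moreover have "norm x \<noteq> 1"
        using no_sphere[OF x] y z \<open>y \<noteq> z\<close> by metis
      ultimately show "x \<in> ball 0 1"
        by simp
    qed
    have "connected K"
      unfolding K_def using cpt W(1) decr'
      by (intro connected_nest) (auto intro: connected_imp_connected_closure path_connected_imp_connected)
    then have "z islimpt K"
      using connected_imp_perfect[of K z] y z \<open>y \<noteq> z\<close> by blast
    then have "\<phi> v - w0 = 0"
      using hol fK Kb z nonconst
      by (intro analytic_continuation[of "\<lambda>w. \<phi> w - w0" "ball 0 1" K z v])
        (auto intro!: holomorphic_intros)
    with nonconst show False by simp
  qed
  show thesis
  proof
    fix e :: real assume "0 < e"
    show "\<exists>n. W n \<subseteq> ball z e"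
    proof (rule ccontr)
      assume contra: "\<not> ?thesis"
      have "(\<Inter>n. closure (W n) \<inter> - ball z e) \<noteq> {}"
      proof (rule compact_nest)
        show "compact (closure (W n) \<inter> - ball z e)" for n
          using cpt by (intro compact_Int_closed) auto
        show "closure (W n) \<inter> - ball z e \<noteq> {}" for n
          using contra closure_subset[of "W n"] by blast
        show "closure (W n) \<inter> - ball z e \<subseteq> closure (W m) \<inter> - ball z e" if "m \<le> n" for m n
          using decr'[OF that] by blast
      qed
      then obtain x where "x \<in> K" "x \<notin> ball z e"
        unfolding K_def by blast
      then show False
        using uniq \<open>0 < e\<close> by force
    qed
  qed (rule zc)
qed

section \<open>Continuity of the radial extension along lifts\<close>

lemma radial_ext_ball: "norm z < 1 \<Longrightarrow> radial_ext \<phi> z = \<phi> z"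
  by (simp add: radial_ext_def)

lemma radial_ext_eqI:
  assumes "norm \<alpha> = 1" "((\<lambda>r. \<phi> (of_real r * \<alpha>)) \<longlongrightarrow> l) (at_left (1::real))"
  shows "radial_ext \<phi> \<alpha> = l"
  using assms tendsto_Lim[OF _ assms(2)] by (simp add: radial_ext_def)

lemma radial_ext_tendsto:
  assumes "\<alpha> \<in> radial_dom \<phi>" "norm \<alpha> = 1"
  shows "((\<lambda>r. \<phi> (of_real r * \<alpha>)) \<longlongrightarrow> radial_ext \<phi> \<alpha>) (at_left (1::real))"
proof -
  obtain l where l: "((\<lambda>r. \<phi> (of_real r * \<alpha>)) \<longlongrightarrow> l) (at_left (1::real))"
    using assms by (auto simp: radial_dom_def)
  with radial_ext_eqI[OF assms(2) l] show ?thesis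
    by simp
qed

lemma radial_dom_subset_cball: "radial_dom \<phi> \<subseteq> cball 0 1"
  by (auto simp: radial_dom_def)

text \<open>The estimate for \<open>(\<phi> - w0) / M\<close>, small up to
  \<open>\<delta> / M\<close> along the path, becomes \<open>\<delta> * M\<close> after
  multiplication by \<open>M\<^sup>2\<close>. As \<open>g\<close> runs inside
  \<open>radial_dom \<phi>\<close>, every circle point on it has a radial limit and the exceptional
  set is empty.\<close>

lemma reflection_estimate_rotated:
  assumes hol: "\<phi> holomorphic_on ball 0 1"
    and M: "0 < M" "\<And>w. w \<in> ball 0 1 \<Longrightarrow> norm (\<phi> w - w0) \<le> M"
    and u: "norm u = 1"
    and g: "path g" "path_image g \<subseteq> radial_dom \<phi>"
    and ends: "pathstart g = of_real b * u" "pathfinish g = of_real c * u"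
    and z: "z \<in> open_segment b c"
    and small: "\<And>w. w \<in> path_image g \<Longrightarrow> norm (radial_ext \<phi> w - w0) \<le> \<delta>"
    and "0 \<le> \<delta>"
  shows "(norm (\<phi> (of_real z * u) - w0))\<^sup>2 \<le> \<delta> * M"
proof -
  note uc = unit_mult_cnj[OF u]
  define f where "f = (\<lambda>w. (\<phi> (u * w) - w0) / of_real M)"
  define g' where "g' = (\<lambda>w. cnj u * w) \<circ> g"
  have img: "u * w \<in> path_image g" if "w \<in> path_image g'" for w
    using that by (auto simp: g'_def path_image_compose uc)
  have rot: "u * w \<in> ball 0 1" if "w \<in> ball 0 1" for w
    using that u by (simp add: norm_mult)
  have "(norm (f (of_real z)))\<^sup>2 \<le> \<delta> / M"
  proof (rule reflection_estimate[of f g' b c z "{}" "\<delta> / M"])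
    have "(\<phi> \<circ> (\<lambda>w. u * w)) holomorphic_on ball 0 1"
      using rot by (intro holomorphic_on_compose_gen[OF _ hol] holomorphic_intros) auto
    then show "f holomorphic_on ball 0 1"
      unfolding f_def using M by (intro holomorphic_intros) (auto simp: o_def)
    show "norm (f w) \<le> 1" if "w \<in> ball 0 1" for w
      using M(1) M(2)[OF rot[OF that]] by (simp add: f_def norm_divide)
    show "path g'"
      unfolding g'_def using g(1) by (intro path_continuous_image continuous_intros)
    show "path_image g' \<subseteq> cball 0 1"
      using g(2) radial_dom_subset_cball[of \<phi>] u
      by (force simp: g'_def path_image_compose norm_mult)
    show "pathstart g' = of_real b" "pathfinish g' = of_real c"
      using ends uc(1)
      by (simp_all add: g'_def pathstart_compose pathfinish_compose mult.left_commute mult.commute[of "cnj u"])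
    show "norm (f w) \<le> \<delta> / M" if "w \<in> path_image g' \<inter> ball 0 1" for w
      using small[OF img, of w] rot[of w] that M(1)
      by (simp add: f_def norm_divide divide_right_mono radial_ext_ball)
    show "\<forall>\<^sub>F r in at_left 1. norm (f (of_real r * \<alpha>)) \<le> c"
      if \<alpha>: "\<alpha> \<in> path_image g' \<inter> sphere 0 1 - {}" and c: "\<delta> / M < c" for \<alpha> c
    proof -
      have "u * \<alpha> \<in> path_image g" "norm (u * \<alpha>) = 1"
        using \<alpha> img u by (auto simp: norm_mult)
      then have "((\<lambda>r. norm ((\<phi> (of_real r * (u * \<alpha>)) - w0) / of_real M))
          \<longlongrightarrow> norm ((radial_ext \<phi> (u * \<alpha>) - w0) / of_real M)) (at_left (1::real))"
        using g(2) M(1) by (intro tendsto_intros radial_ext_tendsto) auto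
      moreover have "norm ((radial_ext \<phi> (u * \<alpha>) - w0) / of_real M) < c"
        using small[OF \<open>u * \<alpha> \<in> path_image g\<close>] M(1) c divide_right_mono[of _ \<delta> M]
        by (fastforce simp: norm_divide)
      ultimately have "\<forall>\<^sub>F r in at_left (1::real). norm ((\<phi> (of_real r * (u * \<alpha>)) - w0) / of_real M) < c"
        by (rule order_tendstoD(2))
      then show ?thesis
        by (rule eventually_mono) (simp add: f_def mult.left_commute)
    qed
  qed (use z M \<open>0 \<le> \<delta>\<close> in auto)
  then have "(norm (\<phi> (of_real z * u) - w0))\<^sup>2 / M\<^sup>2 \<le> \<delta> / M"
    using M(1) by (simp add: f_def norm_divide power_divide mult.commute)
  then show ?thesis
    using M(1) by (simp add: field_simps power2_eq_square)
qed

text \<open>For \<open>r < 1\<close> the point \<open>r * l s\<close> lies on the radius in the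
  direction \<open>u\<close> of \<open>l s\<close>. The estimate is applied to the path that follows
  the lift from \<open>l s\<close> to \<open>\<alpha> = l s0\<close>, descends the radius of
  \<alpha> to \<open>R * \<alpha>\<close> and crosses over to \<open>R * u\<close>; its ends lie on
  the radius of \<open>u\<close> on either side of \<open>r * l s\<close>. Closeness to
  \<open>w0\<close> on the three pieces comes from \<open>lam\<close>, from the radial limit at
  \<alpha>, and from continuity of \<open>\<phi>\<close> at \<open>R * \<alpha>\<close>.\<close>

lemma radial_ext_estimate_near_lift:
  assumes hol: "\<phi> holomorphic_on ball 0 1" and bd: "bounded (\<phi> ` ball 0 1)"
    and l: "continuous_on {0..1} l" "l ` {0..1} \<subseteq> radial_dom \<phi>"
    and lam: "continuous_on {0..1} (\<lambda>s. radial_ext \<phi> (l s))"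
    and s0: "s0 \<in> {0..1}" "norm (l s0) = 1" and "0 < \<epsilon>"
  obtains d where "0 < d"
    "\<And>s r. s \<in> {0..1} \<Longrightarrow> \<bar>s - s0\<bar> < d \<Longrightarrow> r \<in> {0..1} \<Longrightarrow> 1 - r < d \<Longrightarrow>
        norm (radial_ext \<phi> (of_real r * l s) - radial_ext \<phi> (l s0)) < \<epsilon>"
proof -
  define \<alpha> w0 where "\<alpha> = l s0" and "w0 = radial_ext \<phi> (l s0)"
  have n\<alpha>: "norm \<alpha> = 1"
    using s0 by (simp add: \<alpha>_def)
  have "bounded ((\<lambda>w. \<phi> w - w0) ` ball 0 1)"
    using bd by (rule bounded_minus_comp) (rule bounded_subset[of "{w0}"], auto)
  then obtain M where M: "0 < M" "\<And>w. w \<in> ball 0 1 \<Longrightarrow> norm (\<phi> w - w0) \<le> M"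
    unfolding bounded_pos by blast
  \<comment> \<open>The first term makes the square root of \<open>\<delta> * M\<close> at most
    \<open>\<epsilon> / 2\<close>; the second serves the case \<open>r = 1\<close>, where closeness
    is read off directly.\<close>
  define \<delta> where "\<delta> = min (\<epsilon>\<^sup>2 / (4 * M)) (\<epsilon> / 2)"
  have \<delta>: "0 < \<delta>" "\<delta> < \<epsilon>" "\<delta> * M \<le> (\<epsilon> / 2)\<^sup>2"
  proof -
    have "\<delta> \<le> \<epsilon>\<^sup>2 / (4 * M)"
      by (simp add: \<delta>_def)
    then show "\<delta> * M \<le> (\<epsilon> / 2)\<^sup>2"
      using M by (simp add: field_simps)
  qed (use M \<open>0 < \<epsilon>\<close> in \<open>auto simp: \<delta>_def min_def\<close>)
  have "((\<lambda>r. \<phi> (of_real r * \<alpha>)) \<longlongrightarrow> w0) (at_left (1::real))"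
    unfolding \<alpha>_def w0_def using l s0 by (intro radial_ext_tendsto) auto
  then have "\<forall>\<^sub>F r in at_left (1::real). dist (\<phi> (of_real r * \<alpha>)) w0 < \<delta>"
    using \<delta>(1) by (rule tendstoD)
  then obtain r1 where r1: "r1 < 1" "\<And>r. r1 < r \<Longrightarrow> r < 1 \<Longrightarrow> dist (\<phi> (of_real r * \<alpha>)) w0 < \<delta>"
    unfolding eventually_at_left_field by blast
  obtain R where R: "max r1 0 < R" "R < 1"
    using r1(1) dense[of "max r1 0" 1] by auto
  have R\<alpha>: "of_real R * \<alpha> \<in> ball 0 1"
    using R n\<alpha> by (simp add: norm_mult)
  have "isCont \<phi> (of_real R * \<alpha>)"
    using hol R\<alpha> by (metis at_within_open continuous_on_eq_continuous_within
        holomorphic_on_imp_continuous_on open_ball)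
  moreover have "dist (\<phi> (of_real R * \<alpha>)) w0 < \<delta>"
    using r1 R by auto
  ultimately have "\<forall>\<^sub>F y in at (of_real R * \<alpha>). dist (\<phi> y) w0 < \<delta>"
    by (intro order_tendstoD(2)[of _ "dist (\<phi> (of_real R * \<alpha>)) w0"] tendsto_dist tendsto_const)
      (simp_all add: isCont_def)
  then obtain \<eta>0 where \<eta>0: "0 < \<eta>0" "\<And>y. y \<noteq> of_real R * \<alpha> \<Longrightarrow> dist y (of_real R * \<alpha>) < \<eta>0 \<Longrightarrow> dist (\<phi> y) w0 < \<delta>"
    unfolding eventually_at by blast
  \<comment> \<open>The bound \<open>1 - R\<close> keeps the ball about \<open>R * \<alpha>\<close>
    in the unit disk, and \<open>dist (l s) \<alpha> < \<eta> / 2\<close> then forces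
    \<open>norm (l s) > (1 + R) / 2\<close>.\<close>
  define \<eta> where "\<eta> = min \<eta>0 (1 - R)"
  have \<eta>: "0 < \<eta>" "\<eta> \<le> 1 - R"
    using \<eta>0 R by (auto simp: \<eta>_def)
  have near: "norm y < 1 \<and> dist (\<phi> y) w0 < \<delta>" if y: "y \<in> ball (of_real R * \<alpha>) \<eta>" for y
  proof
    have "norm (of_real R * \<alpha>) = R"
      using R n\<alpha> by (simp add: norm_mult)
    then show "norm y < 1"
      using y \<eta> norm_triangle_ineq2[of y "of_real R * \<alpha>"] by (simp add: dist_norm norm_minus_commute)
    show "dist (\<phi> y) w0 < \<delta>"
      using \<eta>0(2)[of y] y \<open>dist (\<phi> (of_real R * \<alpha>)) w0 < \<delta>\<close> by (cases "y = of_real R * \<alpha>") (auto simp: \<eta>_def dist_commute)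
  qed
  obtain d1 where d1: "0 < d1" "\<And>s. s \<in> {0..1} \<Longrightarrow> dist s s0 < d1 \<Longrightarrow> dist (l s) \<alpha> < \<eta> / 2"
    using l(1) s0(1) \<eta>(1) unfolding continuous_on_iff \<alpha>_def by (metis half_gt_zero)
  obtain d2 where d2: "0 < d2" "\<And>s. s \<in> {0..1} \<Longrightarrow> dist s s0 < d2 \<Longrightarrow> dist (radial_ext \<phi> (l s)) w0 < \<delta>"
    using lam s0(1) \<delta>(1) unfolding continuous_on_iff w0_def by metis
  \<comment> \<open>From \<open>r > 2 * R / (1 + R)\<close> and
    \<open>norm (l s) > (1 + R) / 2\<close> follows \<open>r * norm (l s) > R\<close>, which puts
    the target point between the ends of the path.\<close>
  define d where "d = min (min d1 d2) (1 - 2 * R / (1 + R))"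
  have "2 * R / (1 + R) < 1"
    using R by simp
  then have d: "0 < d" "d \<le> d1" "d \<le> d2" "d \<le> 1 - 2 * R / (1 + R)"
    using d1 d2 by (auto simp: d_def)
  show thesis
  proof (rule that[OF d(1)])
    fix s r :: real
    assume s: "s \<in> {0..1}" "\<bar>s - s0\<bar> < d" and r: "r \<in> {0..1}" "1 - r < d"
    have ls: "dist (l s) \<alpha> < \<eta> / 2"
      using d1(2)[OF s(1)] s d by (simp add: dist_real_def)
    have nls: "(1 + R) / 2 < norm (l s)"
      using norm_triangle_ineq2[of \<alpha> "l s"] ls n\<alpha> \<eta> by (simp add: dist_norm norm_minus_commute)
    define u where "u = l s /\<^sub>R norm (l s)"
    have ls0: "l s \<noteq> 0"
      using nls R by auto
    then have u: "norm u = 1"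
      by (simp add: u_def)
    have lsu: "l s = of_real (norm (l s)) * u"
      using ls0 by (simp add: u_def scaleR_conv_of_real)
    have u\<alpha>: "norm (u - \<alpha>) < \<eta>"
      using norm_radial_projection_diff_le[OF n\<alpha> ls0] ls by (simp add: u_def dist_norm)
    show "norm (radial_ext \<phi> (of_real r * l s) - radial_ext \<phi> (l s0)) < \<epsilon>"
    proof (cases "r = 1")
      case True
      then show ?thesis
        using d2(2)[OF s(1)] s(2) d \<delta> by (simp add: dist_norm dist_real_def w0_def)
    next
      case False
      then have r': "r < 1" "2 * R / (1 + R) < r"
        using r d(4) by auto
      define z where "z = r * norm (l s)"
      have "R < z"
      proof -
        have "R = 2 * R / (1 + R) * ((1 + R) / 2)"
          using R by simp
        also have "\<dots> < r * norm (l s)"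
          using r' nls R order_less_trans[of 0 "2 * R / (1 + R)" r]
          by (intro mult_strict_mono) auto
        finally show ?thesis
          by (simp add: z_def)
      qed
      moreover have "z < norm (l s)"
        using r' ls0 by (simp add: z_def)
      ultimately have z: "z \<in> open_segment (norm (l s)) R"
        by (simp add: open_segment_eq_real_ivl)
      define g where "g = subpath s s0 l +++ linepath \<alpha> (of_real R * \<alpha>) +++ linepath (of_real R * \<alpha>) (of_real R * u)"
      have img: "path_image g = l ` closed_segment s s0 \<union> closed_segment \<alpha> (of_real R * \<alpha>)
          \<union> closed_segment (of_real R * \<alpha>) (of_real R * u)"
        unfolding g_def by (simp add: path_image_join path_image_subpath_gen \<alpha>_def Un_assoc)
      have imgw: "w \<in> radial_dom \<phi> \<and> norm (radial_ext \<phi> w - w0) \<le> \<delta>" if w: "w \<in> path_image g" for w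
      proof -
        consider (1) "w \<in> l ` closed_segment s s0" | (2) "w \<in> closed_segment \<alpha> (of_real R * \<alpha>)"
          | (3) "w \<in> closed_segment (of_real R * \<alpha>) (of_real R * u)"
          using w unfolding img by blast
        then show ?thesis
        proof cases
          case 1
          then obtain s' where s': "w = l s'" "s' \<in> closed_segment s s0"
            by blast
          then have "s' \<in> {0..1}" "dist s' s0 < d2"
            using s s0 d by (auto simp: closed_segment_eq_real_ivl dist_real_def split: if_splits)
          then show ?thesis
            using d2(2)[of s'] l(2) s' by (auto simp: dist_norm)
        next
          case 2
          then obtain t where t: "0 \<le> t" "t \<le> 1" "w = (1 - t) *\<^sub>R \<alpha> + t *\<^sub>R (of_real R * \<alpha>)"
            by (auto simp: in_segment)
          define v where "v = 1 - t * (1 - R)"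
          have wv: "w = of_real v * \<alpha>"
            using t by (simp add: v_def scaleR_conv_of_real algebra_simps)
          have v: "R \<le> v" "v \<le> 1"
          proof -
            have "t * (1 - R) \<le> 1 * (1 - R)"
              using t R by (intro mult_right_mono) auto
            then show "R \<le> v" by (simp add: v_def)
            show "v \<le> 1"
              using t R by (simp add: v_def)
          qed
          show ?thesis
          proof (cases "v = 1")
            case True
            then show ?thesis
              using wv l(2) s0 \<delta> by (auto simp: \<alpha>_def w0_def)
          next
            case False
            then have "norm w < 1" "dist (\<phi> w) w0 < \<delta>"
              using r1(2)[of v] v R n\<alpha> wv by (auto simp: norm_mult)
            then show ?thesis
              by (simp add: radial_ext_ball radial_dom_def dist_norm)
          qed
        next
          case 3
          have "dist (of_real R * \<alpha>) (of_real R * u) = R * norm (u - \<alpha>)"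
            using R by (simp add: dist_norm norm_minus_commute norm_mult flip: right_diff_distrib)
          also have "\<dots> \<le> 1 * norm (u - \<alpha>)"
            using R by (intro mult_right_mono) auto
          finally have "closed_segment (of_real R * \<alpha>) (of_real R * u) \<subseteq> ball (of_real R * \<alpha>) \<eta>"
            using \<eta> u\<alpha> by (intro closed_segment_subset) auto
          then have "norm w < 1" "dist (\<phi> w) w0 < \<delta>"
            using near 3 by auto
          then show ?thesis
            by (simp add: radial_ext_ball radial_dom_def dist_norm)
        qed
      qed
      have "(norm (\<phi> (of_real z * u) - w0))\<^sup>2 \<le> \<delta> * M"
      proof (rule reflection_estimate_rotated[OF hol M u, of g "norm (l s)" R])
        show "path g"
          unfolding g_def using l s s0 by (intro path_join_imp path_subpath) (auto simp: path_def \<alpha>_def)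
        show "pathstart g = of_real (norm (l s)) * u"
          using lsu by (simp add: g_def)
      qed (use imgw z \<delta> in \<open>auto simp: g_def\<close>)
      also have "\<dots> \<le> (\<epsilon> / 2)\<^sup>2"
        by (rule \<delta>(3))
      finally have "norm (\<phi> (of_real z * u) - w0) \<le> \<epsilon> / 2"
        using \<open>0 < \<epsilon>\<close> by (simp add: power2_le_iff_abs_le)
      moreover have zu: "of_real r * l s = of_real z * u"
        using lsu by (metis mult.assoc of_real_mult z_def)
      moreover have "norm (of_real r * l s) < 1"
      proof -
        have "norm (l s) \<le> 1"
          using l(2) s(1) radial_dom_subset_cball[of \<phi>] by force
        then show ?thesis
          using \<open>z < norm (l s)\<close> r by (simp add: norm_mult z_def)
      qed
      ultimately show ?thesis
        using \<open>0 < \<epsilon>\<close> by (simp add: radial_ext_ball w0_def)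
    qed
  qed
qed

text \<open>Where \<open>r * l s\<close> is inside the disk this is continuity of
  \<open>\<phi>\<close>. It can reach the circle only if \<open>r = 1\<close> and
  \<open>norm (l s) = 1\<close>, and there the preceding estimate applies.\<close>

proposition continuous_on_radial_ext_radial_scaling:
  fixes l :: "real \<Rightarrow> complex"
  assumes hol: "\<phi> holomorphic_on ball 0 1" and bd: "bounded (\<phi> ` ball 0 1)"
    and l: "continuous_on {0..1} l" "l ` {0..1} \<subseteq> radial_dom \<phi>"
    and lam: "continuous_on {0..1} (\<lambda>s. radial_ext \<phi> (l s))"
  shows "continuous_on ({0..1} \<times> {0..1}) (\<lambda>x. radial_ext \<phi> (of_real (snd x) * l (fst x)))"
  unfolding continuous_on_def
proof
  fix x :: "real \<times> real" assume x: "x \<in> {0..1} \<times> {0..1}"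
  define S :: "(real \<times> real) set" where "S = {0..1} \<times> {0..1}"
  define Q where "Q = (\<lambda>x::real \<times> real. of_real (snd x) * l (fst x))"
  have "continuous_on S Q"
    unfolding Q_def S_def by (intro continuous_intros continuous_on_compose2[OF l(1)]) auto
  then have Qlim: "(Q \<longlongrightarrow> Q x) (at x within S)"
    using x unfolding continuous_on_def S_def by blast
  have nl: "norm (l s) \<le> 1" if "s \<in> {0..1}" for s
    using l(2) that radial_dom_subset_cball[of \<phi>] by force
  have "((\<lambda>x. radial_ext \<phi> (Q x)) \<longlongrightarrow> radial_ext \<phi> (Q x)) (at x within S)"
  proof (cases "norm (Q x) < 1")
    case True
    have "isCont \<phi> (Q x)"
      using hol True by (metis at_within_open continuous_on_eq_continuous_within
        holomorphic_on_imp_continuous_on open_ball mem_ball_0)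
    then have "((\<lambda>x. \<phi> (Q x)) \<longlongrightarrow> \<phi> (Q x)) (at x within S)"
      using Qlim by (rule isCont_tendsto_compose)
    moreover have "\<forall>\<^sub>F y in at x within S. norm (Q y) < 1"
      using tendsto_norm[OF Qlim] True by (rule order_tendstoD(2))
    then have "\<forall>\<^sub>F y in at x within S. \<phi> (Q y) = radial_ext \<phi> (Q y)"
      by (rule eventually_mono) (simp add: radial_ext_ball)
    ultimately show ?thesis
      using True Lim_transform_eventually by (fastforce simp: radial_ext_ball)
  next
    case False
    obtain s0 r0 where sr: "x = (s0, r0)" "s0 \<in> {0..1}" "r0 \<in> {0..1}"
      using x by auto
    have "1 \<le> r0 * norm (l s0)"
      using False sr by (simp add: Q_def norm_mult)
    moreover have "r0 * norm (l s0) \<le> 1 * norm (l s0)" "r0 * norm (l s0) \<le> r0 * 1"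
      using sr nl[OF sr(2)] by (intro mult_right_mono mult_left_mono; auto)+
    ultimately have one: "r0 = 1" "norm (l s0) = 1"
      using sr nl[OF sr(2)] by auto
    show ?thesis
      unfolding tendsto_iff
    proof (intro allI impI)
      fix e :: real assume "0 < e"
      obtain d where d: "0 < d" "\<And>s r. s \<in> {0..1} \<Longrightarrow> \<bar>s - s0\<bar> < d \<Longrightarrow> r \<in> {0..1} \<Longrightarrow> 1 - r < d \<Longrightarrow>
        norm (radial_ext \<phi> (of_real r * l s) - radial_ext \<phi> (l s0)) < e"
        using radial_ext_estimate_near_lift[OF hol bd l lam sr(2) one(2) \<open>0 < e\<close>] by blast
      have "dist (radial_ext \<phi> (Q y)) (radial_ext \<phi> (Q x)) < e" if "y \<in> S" "dist y x < d" for y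
      proof -
        obtain s r where y: "y = (s, r)" "s \<in> {0..1}" "r \<in> {0..1}"
          using \<open>y \<in> S\<close> by (auto simp: S_def)
        have "\<bar>s - s0\<bar> < d" "\<bar>r - r0\<bar> < d"
          using \<open>dist y x < d\<close> dist_fst_le[of y x] dist_snd_le[of y x]
          by (auto simp: y sr dist_real_def)
        then show ?thesis
          using d(2)[of s r] y one by (simp add: Q_def sr dist_norm)
      qed
      then show "\<forall>\<^sub>F y in at x within S. dist (radial_ext \<phi> (Q y)) (radial_ext \<phi> (Q x)) < e"
        using \<open>0 < d\<close> unfolding eventually_at by blast
    qed
  qed
  then show "((\<lambda>x. radial_ext \<phi> (of_real (snd x) * l (fst x))) \<longlongrightarrow> radial_ext \<phi> (of_real (snd x) * l (fst x)))
      (at x within {0..1} \<times> {0..1})"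
    by (simp add: Q_def S_def)
qed

section \<open>Homotopies and lifts\<close>

lemma lift_with_same_ends_in_hclass:
  assumes hol: "\<phi> holomorphic_on ball 0 1" and bd: "bounded (\<phi> ` ball 0 1)"
    and \<Omega>: "\<phi> ` ball 0 1 \<subseteq> \<Omega>"
    and \<gamma>: "path_epe \<Omega> p q \<gamma>" "is_lift \<phi> \<gamma> gh"
    and lam: "continuous_on {0..1} lam" "lam 0 = p" "lam 1 = q" "is_lift \<phi> lam lh"
    and ends: "lh 0 = gh 0" "lh 1 = gh 1"
  shows "lam \<in> hclass \<Omega> p q \<gamma>"
proof -
  \<comment> \<open>The curve \<open>s \<mapsto> (\<sigma> s, \<rho> s)\<close> runs along the left, bottom and right edges of the unit square;
    \<open>\<tau>\<close> deforms the top edge into it. On those three edges \<open>r * gh s\<close> depends only on the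
    end points of \<open>gh\<close>, so the deformations for \<open>gh\<close> and \<open>lh\<close> can be concatenated.\<close>
  define \<sigma> :: "real \<Rightarrow> real" where "\<sigma> = (\<lambda>s. min 1 (max 0 (3 * s - 1)))"
  define \<rho> :: "real \<Rightarrow> real" where "\<rho> = (\<lambda>s. max 0 (max (1 - 3 * s) (3 * s - 2)))"
  define \<tau> :: "real \<Rightarrow> real \<Rightarrow> real \<times> real" where
    "\<tau> = (\<lambda>t s. ((1 - t) * s + t * \<sigma> s, (1 - t) * 1 + t * \<rho> s))"
  have conv: "(1 - t) * a + t * b \<in> {0..1}" if "a \<in> {0..1}" "b \<in> {0..1}" "t \<in> {0..1}" for a b t :: real
    using that convexD_alt[of "{0..1::real}" a b t] by (simp add: convex_real_interval)
  have \<tau>_square: "\<tau> t s \<in> {0..1} \<times> {0..1}" if "t \<in> {0..1}" "s \<in> {0..1}" for t s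
    unfolding \<tau>_def using that by (intro SigmaI conv) (auto simp: \<sigma>_def \<rho>_def)
  define \<Phi> where "\<Phi> = (\<lambda>l::real \<Rightarrow> complex. \<lambda>x::real \<times> real. radial_ext \<phi> (of_real (snd x) * l (fst x)))"
  have cont\<Phi>: "continuous_on ({0..1} \<times> {0..1}) (\<Phi> l)"
    if "is_lift \<phi> c l" "continuous_on {0..1} c" for l c
  proof -
    have "continuous_on {0..1} (\<lambda>s. radial_ext \<phi> (l s))"
      using that(1) by (intro continuous_on_eq[OF that(2)]) (simp add: is_lift_def)
    then show ?thesis
      unfolding \<Phi>_def using that
      by (intro continuous_on_radial_ext_radial_scaling[OF hol bd]) (auto simp: is_lift_def)
  qed
  have ball: "\<Phi> l x \<in> \<Omega>" if "is_lift \<phi> c l" "fst x \<in> {0..1}" "0 \<le> snd x" "snd x < 1" for l c x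
  proof -
    have "norm (l (fst x)) \<le> 1"
      using that radial_dom_subset_cball[of \<phi>] by (force simp: is_lift_def)
    then have "snd x * norm (l (fst x)) < 1"
      using that by (metis mult_left_le mult.commute order_le_less_trans)
    then have "norm (of_real (snd x) * l (fst x)) < 1"
      using that by (simp add: norm_mult)
    then show ?thesis
      using \<Omega> by (auto simp: \<Phi>_def radial_ext_ball)
  qed
  have agree: "\<Phi> gh (\<tau> 1 s) = \<Phi> lh (\<tau> 1 s)" for s
  proof -
    consider "\<sigma> s = 0" | "\<sigma> s = 1" | "\<rho> s = 0"
    proof -
      have "\<sigma> s = 0" if "s \<le> 1/3"
        using that by (simp add: \<sigma>_def)
      moreover have "\<sigma> s = 1" if "2/3 \<le> s"
        using that by (simp add: \<sigma>_def)
      moreover have "\<rho> s = 0" if "1/3 \<le> s" "s \<le> 2/3"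
        using that by (simp add: \<rho>_def)
      ultimately show thesis
        by (metis that linorder_linear)
    qed
    then show ?thesis
      by cases (use ends in \<open>auto simp: \<Phi>_def \<tau>_def\<close>)
  qed
  \<comment> \<open>The first half contracts the path of \<open>gh\<close> to the common path, the
    second expands that to the path of \<open>lh\<close>. For \<open>0 < t < 1\<close> and interior
    \<open>s\<close> the argument given by \<open>\<tau>\<close> lies strictly below the top edge,
    so the value is in the image of the open disk. At \<open>t = 1\<close> the path
    \<open>lam\<close> may touch the boundary of \<open>\<Omega>\<close>, which
    \<open>hclass\<close> permits.\<close>
  define h where "h = (\<lambda>x::real \<times> real. if snd x \<le> 1/2 then \<Phi> gh (\<tau> (2 * snd x) (fst x))
      else \<Phi> lh (\<tau> (2 - 2 * snd x) (fst x)))"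
  have \<gamma>c: "continuous_on {0..1} \<gamma>" "\<gamma> 0 = p" "\<gamma> 1 = q" "\<gamma> ` {0<..<1} \<subseteq> \<Omega>"
    using \<gamma>(1) by (auto simp: path_epe_def)
  have cont_h: "continuous_on ({0..1} \<times> {0..1}) h"
    unfolding h_def
  proof (rule continuous_on_cases_le)
    have cont\<tau>: "continuous_on A (\<lambda>x. \<tau> (k x) (fst x))" if "continuous_on A k"
      for A :: "(real \<times> real) set" and k
      unfolding \<tau>_def \<sigma>_def \<rho>_def using that by (intro continuous_intros)
    show "continuous_on {t \<in> {0..1} \<times> {0..1}. snd t \<le> 1/2} (\<lambda>x. \<Phi> gh (\<tau> (2 * snd x) (fst x)))"
      by (rule continuous_on_compose2[OF cont\<Phi>[OF \<gamma>(2) \<gamma>c(1)] cont\<tau>])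
        (intro continuous_intros image_subsetI \<tau>_square; auto)+
    show "continuous_on {t \<in> {0..1} \<times> {0..1}. 1/2 \<le> snd t} (\<lambda>x. \<Phi> lh (\<tau> (2 - 2 * snd x) (fst x)))"
      by (rule continuous_on_compose2[OF cont\<Phi>[OF lam(4,1)] cont\<tau>])
        (intro continuous_intros image_subsetI \<tau>_square; auto)+
    show "continuous_on ({0..1} \<times> {0..1}) (snd :: real \<times> real \<Rightarrow> real)"
      by (intro continuous_intros)
    show "\<Phi> gh (\<tau> (2 * snd t) (fst t)) = \<Phi> lh (\<tau> (2 - 2 * snd t) (fst t))"
      if "t \<in> {0..1} \<times> {0..1}" "snd t = 1/2" for t
      unfolding that(2) using agree[of "fst t"] by simp
  qed
  have \<tau>0: "\<tau> 0 s = (s, 1)" and \<tau>ends: "\<tau> t 0 = (0, 1)" "\<tau> t 1 = (1, 1)" for s t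
    by (auto simp: \<tau>_def \<sigma>_def \<rho>_def)
  have top: "\<Phi> gh (s, 1) = \<gamma> s" "\<Phi> lh (s, 1) = lam s" if "s \<in> {0..1}" for s
    using \<gamma>(2) lam(4) that by (auto simp: \<Phi>_def is_lift_def)
  have below: "0 \<le> snd (\<tau> t s)" "snd (\<tau> t s) < 1" if "t \<in> {0<..1}" "s \<in> {0<..<1}" for t s
  proof -
    show "0 \<le> snd (\<tau> t s)"
      using \<tau>_square[of t s] that by (auto simp: mem_Times_iff)
    have "t * \<rho> s < t * 1"
      using that by (intro mult_strict_left_mono) (auto simp: \<rho>_def)
    then show "snd (\<tau> t s) < 1"
      by (simp add: \<tau>_def)
  qed
  show ?thesis
    unfolding hclass_def mem_Collect_eq
  proof (intro exI[of _ h] conjI ballI)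
    show "continuous_on ({0..1} \<times> {0..1}) h"
      by (rule cont_h)
    show "h (s, 0) = \<gamma> s" "h (s, 1) = lam s" if "s \<in> {0..1}" for s
      using top[OF that] by (auto simp: h_def \<tau>0)
    fix t :: real assume t: "t \<in> {0..<1}"
    show "path_epe \<Omega> p q (\<lambda>s. h (s, t))"
      unfolding path_epe_def
    proof (intro conjI)
      show "continuous_on {0..1} (\<lambda>s. h (s, t))"
        using t by (intro continuous_on_compose2[OF cont_h] continuous_intros) auto
      show "h (0, t) = p" "h (1, t) = q"
        using top[of 0] top[of 1] \<gamma>c lam by (auto simp: h_def \<tau>ends)
      show "(\<lambda>s. h (s, t)) ` {0<..<1} \<subseteq> \<Omega>"
      proof clarify
        fix s :: real assume s: "s \<in> {0<..<1}"
        then have fst\<tau>: "fst (\<tau> t' s) \<in> {0..1}" if "t' \<in> {0..1}" for t'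
          using \<tau>_square[of t' s] that by (auto simp: mem_Times_iff)
        consider "t = 0" | "0 < t" "t \<le> 1/2" | "1/2 < t"
          using t by force
        then show "h (s, t) \<in> \<Omega>"
        proof cases
          case 1
          then show ?thesis
            using top[of s] s \<gamma>c by (auto simp: h_def \<tau>0)
        next
          case 2
          then show ?thesis
            using ball[OF \<gamma>(2) fst\<tau> below, of "2 * t"] s by (simp add: h_def)
        next
          case 3
          then show ?thesis
            using ball[OF lam(4) fst\<tau> below, of "2 - 2 * t"] s t by (simp add: h_def)
        qed
      qed
    qed
  qed
qed

section \<open>From homotopies to lifts\<close>

text \<open>If the radial limit were in \<open>\<Omega>\<close>, the image of the closed radius
  would be a path in \<open>\<Omega>\<close> and would lift from 0 to a path \<open>k\<close> in the
  open disk. Uniqueness makes \<open>k\<close> the radius on \<open>{0..<1}\<close>, hence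
  \<open>k 1 = \<alpha>\<close> by continuity, a circle point. This is what keeps \<open>gh\<close>
  in the open disk wherever \<open>\<gamma>\<close> is in \<open>\<Omega>\<close>.\<close>

lemma covering_radial_limit_notin:
  assumes hol: "\<phi> holomorphic_on ball 0 1" and bd: "bounded (\<phi> ` ball 0 1)"
    and cov: "covering_space (ball 0 1) \<phi> \<Omega>"
    and \<alpha>: "\<alpha> \<in> radial_dom \<phi>" "norm \<alpha> = 1"
  shows "radial_ext \<phi> \<alpha> \<notin> \<Omega>"
proof
  assume in\<Omega>: "radial_ext \<phi> \<alpha> \<in> \<Omega>"
  define c where "c = (\<lambda>t. radial_ext \<phi> (of_real t * \<alpha>))"
  \<comment> \<open>Continuity up to the end of a single radius is the case of a constant
    \<open>l\<close>.\<close>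
  have "continuous_on ({0..1} \<times> {0..1}) (\<lambda>x::real \<times> real. radial_ext \<phi> (of_real (snd x) * \<alpha>))"
    using continuous_on_radial_ext_radial_scaling[OF hol bd, where l = "\<lambda>_. \<alpha>"] \<alpha>
    by (simp add: image_subset_iff)
  then have "continuous_on {0..1} (\<lambda>t. (\<lambda>x::real \<times> real. radial_ext \<phi> (of_real (snd x) * \<alpha>)) (0, t))"
    by (rule continuous_on_compose2) (auto intro!: continuous_intros)
  then have contc: "continuous_on {0..1} c"
    by (simp add: c_def)
  have n1: "norm (of_real t * \<alpha>) < 1" if "t \<in> {0..<1}" for t :: real
    using that \<alpha> by (simp add: norm_mult)
  have c_eq: "c t = \<phi> (of_real t * \<alpha>)" if "t \<in> {0..<1}" for t
    using n1[OF that] by (simp add: c_def radial_ext_ball)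
  have c\<Omega>: "c t \<in> \<Omega>" if "t \<in> {0..1}" for t
  proof (cases "t = 1")
    case False
    then show ?thesis
      using that c_eq[of t] n1[of t] cov by (auto simp: covering_space_def)
  qed (use in\<Omega> in \<open>simp add: c_def\<close>)
  obtain k where k: "path k" "path_image k \<subseteq> ball 0 1" "pathstart k = 0"
    "\<And>t. t \<in> {0..1} \<Longrightarrow> \<phi> (k t) = c t"
  proof (rule covering_space_lift_path_strong[OF cov, of 0 c])
    show "path c"
      using contc by (simp add: path_def)
    show "path_image c \<subseteq> \<Omega>"
      using c\<Omega> by (auto simp: path_image_def)
    show "pathstart c = \<phi> 0"
      using c_eq[of 0] by (simp add: pathstart_def)
  qed auto
  have k_eq: "k t = of_real t * \<alpha>" if "t \<in> {0..<1}" for t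
  proof (rule covering_space_lift_unique[OF cov, of k 0 "\<lambda>t. of_real t * \<alpha>" "{0..<1}" c])
    show "continuous_on {0..<1} c" "continuous_on {0..<1} k"
      using contc k(1) by (auto simp: path_def elim: continuous_on_subset)
    show "k \<in> {0..<1} \<rightarrow> ball 0 1"
      using k(2) by (force simp: path_image_def)
    show "k 0 = of_real 0 * \<alpha>"
      using k(3) by (simp add: pathstart_def)
    show "continuous_on {0..<1} (\<lambda>t. of_real t * \<alpha>)"
      by (intro continuous_intros)
    show "c \<in> {0..<1} \<rightarrow> \<Omega>"
      using c\<Omega> by auto
    show "(\<lambda>t. of_real t * \<alpha>) \<in> {0..<1} \<rightarrow> ball 0 1"
      using n1 by auto
    show "c t = \<phi> (k t)" if "t \<in> {0..<1}" for t
      using k(4)[of t] that by simp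
    show "c t = \<phi> (of_real t * \<alpha>)" if "t \<in> {0..<1}" for t
      by (rule c_eq[OF that])
  qed (use that in auto)
  have "k 1 - of_real 1 * \<alpha> = 0"
  proof (rule continuous_constant_on_closure[of "{0..<1}" "\<lambda>t. k t - of_real t * \<alpha>"])
    show "continuous_on (closure {0..<1}) (\<lambda>t. k t - of_real t * \<alpha>)"
      using k(1) by (auto simp: path_def intro!: continuous_intros)
  qed (use k_eq in auto)
  moreover have "k 1 \<in> ball 0 1"
    using k(2) unfolding path_image_def image_subset_iff by (rule bspec) simp
  ultimately show False
    using \<alpha> by simp
qed

text \<open>On small convex pieces of \<open>U\<close> near \<open>x\<close> the values of
  \<open>\<phi> \<circ> H\<close> are close to \<open>h x\<close>, so the images of these pieces
  under \<open>H\<close> shrink to one point, which is taken as \<open>Z x\<close>. The last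
  conclusion comes from the same argument for thin strips along a whole side.\<close>

lemma lift_extends_to_closed_square:
  fixes h H :: "real \<times> real \<Rightarrow> complex" and S U :: "(real \<times> real) set"
  defines "S \<equiv> {0..1} \<times> {0..1}" and "U \<equiv> {0<..<1} \<times> {0..<1}"
  assumes hol: "\<phi> holomorphic_on ball 0 1" and bd: "bounded (\<phi> ` ball 0 1)"
    and nonconst: "\<And>w. \<exists>v\<in>ball 0 1. \<phi> v \<noteq> w"
    and h: "continuous_on S h"
    and H: "continuous_on U H" "\<And>x. x \<in> U \<Longrightarrow> H x \<in> ball 0 1" "\<And>x. x \<in> U \<Longrightarrow> \<phi> (H x) = h x"
  obtains Z where "continuous_on S Z" "Z ` S \<subseteq> radial_dom \<phi>"
    "\<And>x. x \<in> S \<Longrightarrow> radial_ext \<phi> (Z x) = h x" "\<And>x. x \<in> U \<Longrightarrow> Z x = H x"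
    "\<And>\<sigma> c. \<sigma> \<in> {0, 1} \<Longrightarrow> \<forall>t\<in>{0..<1}. h (\<sigma>, t) = c \<Longrightarrow> Z (\<sigma>, 1) = Z (\<sigma>, 0)"
proof -
  have US: "U \<subseteq> S"
    by (auto simp: U_def S_def)
  have "convex U"
    unfolding U_def by (intro convex_Times convex_real_interval)
  \<comment> \<open>The segment from \<open>x\<close> to the centre of the square enters
    \<open>U\<close> at once. It shows that \<open>U\<close> is dense in the square and supplies the
    approach path for Lindelof's theorem.\<close>
  define pt where "pt = (\<lambda>x t. ((1 - t) * fst x + t / 2, (1 - t) * snd x + t / 2) :: real \<times> real)"
  have mid: "0 < (1 - t) * a + t / 2 \<and> (1 - t) * a + t / 2 < 1" if "a \<in> {0..1}" "t \<in> {0<..1}" for a t :: real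
  proof -
    have "0 \<le> (1 - t) * a" "(1 - t) * a \<le> (1 - t) * 1"
      using that by (intro mult_nonneg_nonneg mult_left_mono; simp)+
    then show ?thesis
      using that by auto
  qed
  have ptU: "pt x t \<in> U" if "x \<in> S" "t \<in> {0<..1}" for x t
    using mid[of "fst x" t] mid[of "snd x" t] that by (auto simp: pt_def S_def U_def)
  have pt0: "pt x 0 = x" for x
    by (simp add: pt_def)
  have cont_pt: "continuous_on A (pt x)" for A x
    unfolding pt_def by (intro continuous_intros) auto
  have pt_near: "\<exists>t\<in>{0<..1}. dist (pt x t) x < d" if "0 < d" for x d
  proof -
    have "isCont (pt x) 0"
      using cont_pt[of UNIV x] by (simp add: continuous_on_eq_continuous_at)
    then obtain e where e: "0 < e" "\<And>t. dist t 0 < e \<Longrightarrow> dist (pt x t) (pt x 0) < d"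
      using \<open>0 < d\<close> unfolding continuous_at_eps_delta by blast
    then have "dist (pt x (min 1 (e / 2))) x < d"
      using e(2)[of "min 1 (e / 2)"] by (simp add: pt0 min_def split: if_splits)
    then show ?thesis
      using e(1) by (intro bexI[of _ "min 1 (e / 2)"]) auto
  qed
  have "\<exists>z. z \<in> cball 0 1 \<and> (\<forall>e>0. \<exists>d>0. H ` (U \<inter> ball x d) \<subseteq> ball z e)" if x: "x \<in> S" for x
  proof -
    obtain v where v: "v \<in> ball 0 1" "\<phi> v \<noteq> h x"
      using nonconst by blast
    define W where "W = (\<lambda>n. H ` (U \<inter> ball x (inverse (real (Suc n)))))"
    obtain z where z: "z \<in> cball 0 1" "\<And>e. 0 < e \<Longrightarrow> \<exists>n. W n \<subseteq> ball z e"
    proof (rule nested_sets_shrink_to_point[OF hol bd v, of W])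
      fix n
      have "convex (U \<inter> ball x (inverse (real (Suc n))))"
        using \<open>convex U\<close> by (intro convex_Int) auto
      then show "path_connected (W n)"
        unfolding W_def
        by (intro path_connected_continuous_image convex_imp_path_connected continuous_on_subset[OF H(1)]) auto
      show "W n \<noteq> {}"
        using pt_near[of "inverse (real (Suc n))" x] ptU[OF x] by (force simp: W_def dist_commute)
      show "W n \<subseteq> ball 0 1"
        using H(2) by (auto simp: W_def)
    next
      fix m n :: nat assume "m \<le> n"
      then have "ball x (inverse (real (Suc n))) \<subseteq> ball x (inverse (real (Suc m)))"
        by (intro subset_ball le_imp_inverse_le) auto
      then show "W n \<subseteq> W m"
        unfolding W_def by blast
    next
      fix e :: real assume "0 < e"
      then obtain d where d: "0 < d" "\<And>y. y \<in> S \<Longrightarrow> dist y x < d \<Longrightarrow> dist (h y) (h x) < e"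
        using h x unfolding continuous_on_iff by blast
      obtain n where n: "inverse (real (Suc n)) < d"
        using d(1) reals_Archimedean by blast
      have "dist (\<phi> (H y)) (h x) \<le> e" if "y \<in> U" "y \<in> ball x (inverse (real (Suc n)))" for y
      proof -
        have "dist y x < d"
          using that n by (simp add: dist_commute)
        then show ?thesis
          using d(2)[of y] that(1) US H(3)[OF that(1)] by auto
      qed
      then show "\<exists>n. \<forall>w\<in>W n. dist (\<phi> w) (h x) \<le> e"
        unfolding W_def by blast
    qed blast
    have "\<exists>d>0. H ` (U \<inter> ball x d) \<subseteq> ball z e" if "0 < e" for e
      using z(2)[OF that] unfolding W_def by (metis inverse_positive_iff_positive of_nat_0_less_iff zero_less_Suc)
    then show ?thesis
      using z(1) by blast
  qed
  then obtain Z where Z: "\<And>x. x \<in> S \<Longrightarrow> Z x \<in> cball 0 1"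
    "\<And>x e. x \<in> S \<Longrightarrow> 0 < e \<Longrightarrow> \<exists>d>0. H ` (U \<inter> ball x d) \<subseteq> ball (Z x) e"
    by metis
  have ZH: "Z x = H x" if x: "x \<in> U" for x
  proof (rule ccontr)
    assume "Z x \<noteq> H x"
    then have "0 < dist (Z x) (H x)"
      by simp
    then obtain d where d: "0 < d" "H ` (U \<inter> ball x d) \<subseteq> ball (Z x) (dist (Z x) (H x))"
      using Z(2) x US by (meson subsetD)
    have "H x \<in> H ` (U \<inter> ball x d)"
      using x d(1) by (intro imageI) simp
    then have "H x \<in> ball (Z x) (dist (Z x) (H x))"
      using d(2) by blast
    then show False
      by simp
  qed
  have Zcont: "continuous_on S Z"
    unfolding continuous_on_iff
  proof (intro ballI allI impI)
    fix x e assume x: "x \<in> S" and e: "0 < (e::real)"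
    then have "0 < e / 2" by simp
    then obtain d where d: "0 < d" "H ` (U \<inter> ball x d) \<subseteq> ball (Z x) (e / 2)"
      using Z(2)[OF x] by blast
    \<comment> \<open>A point \<open>pt y t\<close> of \<open>U\<close> that is close to
      \<open>y\<close> and still in \<open>ball x d\<close> lets \<open>Z y\<close> and
      \<open>Z x\<close> be compared through a single value of \<open>H\<close>.\<close>
    have "dist (Z y) (Z x) < e" if y: "y \<in> S" "dist y x < d" for y
    proof -
      obtain d' where d': "0 < d'" "H ` (U \<inter> ball y d') \<subseteq> ball (Z y) (e / 2)"
        using Z(2)[OF y(1) \<open>0 < e / 2\<close>] by blast
      have "0 < min d' (d - dist y x)"
        using d' y by simp
      then obtain t where t: "t \<in> {0<..1}" "dist (pt y t) y < min d' (d - dist y x)"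
        using pt_near by blast
      have "pt y t \<in> U \<inter> ball y d'"
        using t ptU[OF y(1)] by (simp add: dist_commute)
      moreover have "pt y t \<in> U \<inter> ball x d"
        using t ptU[OF y(1)] dist_triangle[of "pt y t" x y] by (simp add: dist_commute)
      ultimately have "H (pt y t) \<in> ball (Z y) (e / 2)" "H (pt y t) \<in> ball (Z x) (e / 2)"
        using d(2) d'(2) by blast+
      then have "dist (Z y) (H (pt y t)) < e / 2" "dist (Z x) (H (pt y t)) < e / 2"
        by (simp_all only: mem_ball)
      then show ?thesis
        using dist_triangle2[of "Z y" "Z x" "H (pt y t)"] by linarith
    qed
    then show "\<exists>d>0. \<forall>x'\<in>S. dist x' x < d \<longrightarrow> dist (Z x') (Z x) < e"
      using d(1) by blast
  qed
  have ext: "Z x \<in> radial_dom \<phi> \<and> radial_ext \<phi> (Z x) = h x" if x: "x \<in> S" for x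
  proof -
    \<comment> \<open>Along this path \<open>\<phi>\<close> tends to \<open>h x\<close>; if
      \<open>Z x\<close> is on the circle, Lindelof's theorem turns this asymptotic value into the
      radial limit at \<open>Z x\<close>.\<close>
    define \<kappa> where "\<kappa> = (\<lambda>t. Z (pt x t))"
    have ptS: "pt x t \<in> S" if "t \<in> {0..1}" for t
      using ptU[OF x, of t] pt0[of x] that x US by (cases "t = 0") auto
    have path: "path \<kappa>"
      unfolding path_def \<kappa>_def
      by (intro continuous_on_compose2[OF Zcont cont_pt]) (use ptS in auto)
    have \<kappa>0: "\<kappa> 0 = Z x"
      by (simp add: \<kappa>_def pt0)
    have \<kappa>H: "\<kappa> t \<in> ball 0 1" "\<phi> (\<kappa> t) = h (pt x t)" if "t \<in> {0<..1}" for t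
      using ptU[OF x that] H ZH by (auto simp: \<kappa>_def)
    have ev: "\<forall>\<^sub>F t in at_right (0::real). t \<in> {0<..1}"
      using eventually_at_right_real[of 0 1] by (rule eventually_mono) auto
    have at0: "at_right (0::real) = at 0 within {0<..1}"
      by (rule at_within_nhd[of _ "{..<1}"]) auto
    have "continuous_on {0..1} (\<lambda>t. h (pt x t))"
      by (intro continuous_on_compose2[OF h cont_pt]) (use ptS in auto)
    then have "((\<lambda>t. h (pt x t)) \<longlongrightarrow> h (pt x 0)) (at 0 within {0..1})"
      unfolding continuous_on_def by (rule bspec) simp
    then have "((\<lambda>t. h (pt x t)) \<longlongrightarrow> h x) (at_right 0)"
      unfolding at0 pt0 by (rule tendsto_within_subset) auto
    then have lim: "((\<lambda>t. \<phi> (\<kappa> t)) \<longlongrightarrow> h x) (at_right 0)"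
      using ev \<kappa>H(2) by (elim Lim_transform_eventually) (auto elim: eventually_mono)
    show ?thesis
    proof (cases "norm (Z x) < 1")
      case True
      then have "isCont \<phi> (Z x)"
        using hol by (metis at_within_open continuous_on_eq_continuous_within
            holomorphic_on_imp_continuous_on open_ball mem_ball_0)
      moreover have "(\<kappa> \<longlongrightarrow> \<kappa> 0) (at 0 within {0..1})"
        using path unfolding path_def continuous_on_def by (rule bspec) simp
      then have "(\<kappa> \<longlongrightarrow> Z x) (at_right 0)"
        unfolding at0 \<kappa>0 by (rule tendsto_within_subset) auto
      ultimately have "((\<lambda>t. \<phi> (\<kappa> t)) \<longlongrightarrow> \<phi> (Z x)) (at_right 0)"
        by (rule isCont_tendsto_compose)
      then have "\<phi> (Z x) = h x"
        using lim tendsto_unique trivial_limit_at_right_real by blast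
      then show ?thesis
        using True by (simp add: radial_ext_ball radial_dom_def)
    next
      case False
      then have n1: "norm (Z x) = 1"
        using Z(1)[OF x] by simp
      have "((\<lambda>r. \<phi> (of_real r * Z x)) \<longlongrightarrow> h x) (at_left (1::real))"
        by (rule Lindelof[OF hol bd path \<kappa>0 n1 _ lim]) (use \<kappa>H(1) in auto)
      then show ?thesis
        using n1 radial_ext_eqI by (auto simp: radial_dom_def)
    qed
  qed
  have side: "Z (\<sigma>, 1) = Z (\<sigma>, 0)" if \<sigma>: "\<sigma> \<in> {0, 1}" and c: "\<forall>t\<in>{0..<1}. h (\<sigma>, t) = c" for \<sigma> c
  proof -
    obtain v where v: "v \<in> ball 0 1" "\<phi> v \<noteq> c"
      using nonconst by blast
    \<comment> \<open>These strips shrink to the side instead of a point. They are convex, and by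
      uniform continuity \<open>h\<close> is close to \<open>c\<close> on thin ones, so
      \<open>H\<close> contracts them to one point, which must be the value of \<open>Z\<close> all
      along the side.\<close>
    define V where "V = (\<lambda>n. ({0<..<1} \<inter> ball \<sigma> (inverse (real (Suc n)))) \<times> {0..<1::real})"
    have VU: "V n \<subseteq> U" for n
      by (auto simp: V_def U_def)
    have reach: "\<exists>y\<in>V n. y \<in> ball (\<sigma>, t) d" if td: "t \<in> {0..1}" "0 < d" for n t d
    proof -
      have "(\<sigma>, t) \<in> S"
        using \<sigma> td by (auto simp: S_def)
      have "0 < min d (inverse (real (Suc n)))"
        using td by simp
      then obtain s where s: "s \<in> {0<..1}" "dist (pt (\<sigma>, t) s) (\<sigma>, t) < min d (inverse (real (Suc n)))"
        using pt_near by blast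
      have "dist (fst (pt (\<sigma>, t) s)) \<sigma> < inverse (real (Suc n))"
        using s dist_fst_le[of "pt (\<sigma>, t) s" "(\<sigma>, t)"] by simp
      then have "pt (\<sigma>, t) s \<in> V n"
        using ptU[OF \<open>(\<sigma>, t) \<in> S\<close> s(1)] by (auto simp: V_def U_def mem_Times_iff dist_commute)
      then show ?thesis
        using s by (intro bexI[of _ "pt (\<sigma>, t) s"]) (auto simp: dist_commute)
    qed
    obtain z where z: "\<And>e. 0 < e \<Longrightarrow> \<exists>n. H ` V n \<subseteq> ball z e"
    proof (rule nested_sets_shrink_to_point[OF hol bd v, of "\<lambda>n. H ` V n"])
      fix n
      have "convex (V n)"
        unfolding V_def by (intro convex_Times convex_Int convex_real_interval convex_ball)
      then show "path_connected (H ` V n)"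
        by (intro path_connected_continuous_image convex_imp_path_connected continuous_on_subset[OF H(1) VU])
      show "H ` V n \<noteq> {}"
        using reach[of 0 1 n] by auto
      show "H ` V n \<subseteq> ball 0 1"
        using H(2) VU by blast
    next
      fix m n :: nat assume "m \<le> n"
      then have "ball \<sigma> (inverse (real (Suc n))) \<subseteq> ball \<sigma> (inverse (real (Suc m)))"
        by (intro subset_ball le_imp_inverse_le) auto
      then show "H ` V n \<subseteq> H ` V m"
        unfolding V_def by blast
    next
      fix e :: real assume "0 < e"
      have "compact S"
        unfolding S_def by (intro compact_Times) auto
      then have "uniformly_continuous_on S h"
        using h compact_uniformly_continuous by blast
      then obtain d where d: "0 < d" "\<And>x y. x \<in> S \<Longrightarrow> y \<in> S \<Longrightarrow> dist y x < d \<Longrightarrow> dist (h y) (h x) < e"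
        using \<open>0 < e\<close> unfolding uniformly_continuous_on_def by blast
      obtain n where n: "inverse (real (Suc n)) < d"
        using d(1) reals_Archimedean by blast
      have "dist (\<phi> (H y)) c \<le> e" if y: "y \<in> V n" for y
      proof -
        obtain s t where st: "y = (s, t)" "s \<in> {0<..<1}" "t \<in> {0..<1}" "dist s \<sigma> < d"
          using y n by (auto simp: V_def dist_commute)
        have "dist (h y) (h (\<sigma>, t)) < e"
          using st \<sigma> by (intro d(2)) (auto simp: S_def dist_prod_def)
        moreover have "y \<in> U"
          using y VU by blast
        ultimately show ?thesis
          using H(3)[of y] bspec[OF c st(3)] by simp
      qed
      then show "\<exists>n. \<forall>w\<in>H ` V n. dist (\<phi> w) c \<le> e"
        by blast
    qed blast
    have "Z (\<sigma>, t) = z" if t: "t \<in> {0..1}" for t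
    proof (rule ccontr)
      assume "Z (\<sigma>, t) \<noteq> z"
      define e where "e = dist (Z (\<sigma>, t)) z / 2"
      have "0 < e"
        using \<open>Z (\<sigma>, t) \<noteq> z\<close> by (simp add: e_def)
      have "(\<sigma>, t) \<in> S"
        using \<sigma> t by (auto simp: S_def)
      then obtain d where d: "0 < d" "H ` (U \<inter> ball (\<sigma>, t) d) \<subseteq> ball (Z (\<sigma>, t)) e"
        using Z(2) \<open>0 < e\<close> by blast
      obtain n where n: "H ` V n \<subseteq> ball z e"
        using z[OF \<open>0 < e\<close>] by blast
      obtain y where y: "y \<in> V n" "y \<in> ball (\<sigma>, t) d"
        using reach[OF t d(1)] by blast
      have "y \<in> U"
        using y VU by blast
      then have "H y \<in> ball (Z (\<sigma>, t)) e" "H y \<in> ball z e"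
        using d(2) n y by blast+
      then have "dist (Z (\<sigma>, t)) (H y) < e" "dist z (H y) < e"
        by (simp_all only: mem_ball)
      then show False
        using dist_triangle2[of "Z (\<sigma>, t)" z "H y"] by (simp add: e_def)
    qed
    then show ?thesis
      by simp
  qed
  show thesis
    using ext by (intro that[OF Zcont _ _ ZH side]) auto
qed

text \<open>The covering property does not lift \<open>lam\<close> itself, which may leave
  \<open>\<Omega>\<close>; its lift is the top edge of the extended lift of the homotopy. The end
  points persist because \<open>h\<close> is constant along each side below the top corner.\<close>

lemma hclass_imp_lift_with_same_ends:
  assumes hol: "\<phi> holomorphic_on ball 0 1" and bd: "bounded (\<phi> ` ball 0 1)"
    and cov: "covering_space (ball 0 1) \<phi> \<Omega>" and "open \<Omega>"
    and \<gamma>: "path_epe \<Omega> p q \<gamma>" "is_lift \<phi> \<gamma> gh"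
    and lam: "lam \<in> hclass \<Omega> p q \<gamma>"
  obtains lh where "is_lift \<phi> lam lh" "lh 0 = gh 0" "lh 1 = gh 1"
proof -
  have im: "\<phi> ` ball 0 1 = \<Omega>"
    using cov by (simp add: covering_space_def)
  obtain h :: "real \<times> real \<Rightarrow> complex" where "continuous_on ({0..1} \<times> {0..1}) h
      \<and> (\<forall>s\<in>{0..1}. h (s, 0) = \<gamma> s \<and> h (s, 1) = lam s)
      \<and> (\<forall>t\<in>{0..<1}. path_epe \<Omega> p q (\<lambda>s. h (s, t)))"
    using lam unfolding hclass_def by (elim CollectE exE)
  then have h: "continuous_on ({0..1} \<times> {0..1}) h"
    "\<And>s. s \<in> {0..1} \<Longrightarrow> h (s, 0) = \<gamma> s" "\<And>s. s \<in> {0..1} \<Longrightarrow> h (s, 1) = lam s"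
    "\<And>t. t \<in> {0..<1} \<Longrightarrow> path_epe \<Omega> p q (\<lambda>s. h (s, t))"
    by auto
  have \<gamma>': "continuous_on {0..1} \<gamma>" "\<And>s. s \<in> {0<..<1} \<Longrightarrow> \<gamma> s \<in> \<Omega>"
    using \<gamma>(1) by (auto simp: path_epe_def)
  have gh: "continuous_on {0..1} gh" "\<And>s. s \<in> {0..1} \<Longrightarrow> gh s \<in> radial_dom \<phi>"
    "\<And>s. s \<in> {0..1} \<Longrightarrow> radial_ext \<phi> (gh s) = \<gamma> s"
    using \<gamma>(2) by (auto simp: is_lift_def)
  have gh_ball: "gh s \<in> ball 0 1" "\<phi> (gh s) = \<gamma> s" if s: "s \<in> {0<..<1}" for s
  proof -
    have "norm (gh s) \<le> 1"
      using gh(2)[of s] s radial_dom_subset_cball[of \<phi>] by force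
    moreover have "norm (gh s) \<noteq> 1"
      using covering_radial_limit_notin[OF hol bd cov, of "gh s"] gh(2,3)[of s] \<gamma>'(2)[OF s] s by auto
    ultimately show "gh s \<in> ball 0 1"
      by simp
    then show "\<phi> (gh s) = \<gamma> s"
      using gh(3)[of s] s by (simp add: radial_ext_ball)
  qed
  \<comment> \<open>The part of the square where \<open>h\<close> is known to lie in
    \<open>\<Omega>\<close>: on the sides it equals \<open>p\<close> or \<open>q\<close>, possibly
    boundary points, and the top edge carries \<open>lam\<close>.\<close>
  define U :: "(real \<times> real) set" where "U = {0<..<1} \<times> {0..<1}"
  have "convex U"
    unfolding U_def by (intro convex_Times convex_real_interval)
  have h\<Omega>: "h x \<in> \<Omega>" if "x \<in> U" for x
    using h(4)[of "snd x"] that by (cases x) (auto simp: U_def path_epe_def image_subset_iff)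
  obtain H where H: "continuous_on U H" "H \<in> U \<rightarrow> ball 0 1" "H (1/2, 0) = gh (1/2)"
    "\<And>x. x \<in> U \<Longrightarrow> \<phi> (H x) = h x"
  proof (rule covering_space_lift_strong[OF cov, of "gh (1/2)" "(1/2, 0)" U h])
    show "simply_connected U" "locally path_connected U"
      using \<open>convex U\<close> by (auto intro: convex_imp_simply_connected convex_imp_locally_path_connected)
    show "continuous_on U h"
      by (rule continuous_on_subset[OF h(1)]) (auto simp: U_def)
    show "h (1/2, 0) = \<phi> (gh (1/2))"
      using h(2)[of "1/2"] gh_ball[of "1/2"] by simp
  qed (use gh_ball[of "1/2"] h\<Omega> in \<open>auto simp: U_def\<close>)
  \<comment> \<open>The covering lift is pinned only at \<open>(1/2, 0)\<close>; uniqueness over the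
    connected open bottom edge identifies it with \<open>gh\<close>.\<close>
  have H0: "H (s, 0) = gh s" if "s \<in> {0<..<1}" for s
  proof (rule covering_space_lift_unique[OF cov, of "\<lambda>s. H (s, 0)" "1/2" gh "{0<..<1}" \<gamma>])
    show "continuous_on {0<..<1} \<gamma>" "continuous_on {0<..<1} gh"
      using \<gamma>' gh by (auto elim!: continuous_on_subset)
    show "continuous_on {0<..<1} (\<lambda>s. H (s, 0))"
      by (intro continuous_on_compose2[OF H(1)] continuous_intros) (auto simp: U_def)
    show "(\<lambda>s. H (s, 0)) \<in> {0<..<1} \<rightarrow> ball 0 1"
      using H(2) by (auto simp: U_def Pi_iff)
    show "\<gamma> s = \<phi> (H (s, 0))" if "s \<in> {0<..<1}" for s
      using H(4)[of "(s, 0)"] h(2)[of s] that by (simp add: U_def)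
  qed (use that H(3) gh_ball \<gamma>' in auto)
  have nonconst: "\<exists>v\<in>ball 0 1. \<phi> v \<noteq> w" for w
  proof (rule ccontr)
    assume "\<not> ?thesis"
    then have "\<phi> ` ball 0 1 \<subseteq> {w}"
      by auto
    moreover have "\<phi> 0 \<in> \<phi> ` ball 0 1"
      by (intro imageI) simp
    ultimately have "\<Omega> = {w}"
      unfolding im by blast
    then show False
      using \<open>open \<Omega>\<close> not_open_singleton by blast
  qed
  obtain Z where Z: "continuous_on ({0..1} \<times> {0..1}) Z" "Z ` ({0..1} \<times> {0..1}) \<subseteq> radial_dom \<phi>"
    "\<And>x. x \<in> {0..1} \<times> {0..1} \<Longrightarrow> radial_ext \<phi> (Z x) = h x" "\<And>x. x \<in> U \<Longrightarrow> Z x = H x"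
    "\<And>\<sigma> c. \<sigma> \<in> {0, 1} \<Longrightarrow> \<forall>t\<in>{0..<1}. h (\<sigma>, t) = c \<Longrightarrow> Z (\<sigma>, 1) = Z (\<sigma>, 0)"
    by (rule lift_extends_to_closed_square[OF hol bd nonconst h(1), of H, folded U_def,
        OF H(1) funcset_mem[OF H(2)] H(4)]) (assumption, assumption, rule that)
  \<comment> \<open>The ends of \<open>gh\<close> may be circle points, out of reach of the
    covering; they are recovered by continuity from the open edge.\<close>
  have Z0: "Z (s, 0) = gh s" if "s \<in> {0..1}" for s
  proof -
    have "Z (s, 0) - gh s = 0"
    proof (rule continuous_constant_on_closure[of "{0<..<1}" "\<lambda>s. Z (s, 0) - gh s"])
      show "continuous_on (closure {0<..<1}) (\<lambda>s. Z (s, 0) - gh s)"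
        using gh(1) by (auto intro!: continuous_intros continuous_on_compose2[OF Z(1)])
      show "Z (s, 0) - gh s = 0" if "s \<in> {0<..<1}" for s
        using Z(4)[of "(s, 0)"] H0[OF that] that by (simp add: U_def)
    qed (use that in auto)
    then show ?thesis by simp
  qed
  have ends: "h (0, t) = p" "h (1, t) = q" if "t \<in> {0..<1}" for t
    using h(4)[OF that] by (auto simp: path_epe_def)
  show thesis
  proof (rule that[of "\<lambda>s. Z (s, 1)"])
    show "is_lift \<phi> lam (\<lambda>s. Z (s, 1))"
      unfolding is_lift_def
    proof (intro conjI ballI)
      show "continuous_on {0..1} (\<lambda>s. Z (s, 1))"
        by (intro continuous_on_compose2[OF Z(1)] continuous_intros) auto
      show "(\<lambda>s. Z (s, 1)) ` {0..1} \<subseteq> radial_dom \<phi>"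
        using Z(2) by (auto simp: image_subset_iff)
      show "radial_ext \<phi> (Z (s, 1)) = lam s" if "s \<in> {0..1}" for s
        using Z(3)[of "(s, 1)"] h(3)[OF that] that by simp
    qed
    show "Z (0, 1) = gh 0" "Z (1, 1) = gh 1"
      using Z(5)[of 0 p] Z(5)[of 1 q] ends Z0[of 0] Z0[of 1] by auto
  qed
qed

theorem theorem2p9:
  fixes \<Omega> :: "complex set" and \<phi> :: "complex \<Rightarrow> complex"
    and p q ph qh :: complex and \<gamma> gh :: "real \<Rightarrow> complex"
  assumes "bounded \<Omega>" and "connected \<Omega>" and "open \<Omega>"
    and "\<phi> holomorphic_on ball 0 1" and "covering_space (ball 0 1) \<phi> \<Omega>"
    and "p \<in> closure \<Omega>" and "q \<in> closure \<Omega>"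
    and "path_epe \<Omega> p q \<gamma>"
    and "is_lift \<phi> \<gamma> gh" and "gh 0 = ph" and "gh 1 = qh"
  shows "(\<forall>lam\<in>hclass \<Omega> p q \<gamma>. \<exists>lh. is_lift \<phi> lam lh \<and> lh ` {0..1} \<subseteq> cball 0 1
             \<and> lh 0 = ph \<and> lh 1 = qh)
       \<and> (\<forall>lam lh. continuous_on {0..1} lam \<and> lam ` {0..1} \<subseteq> closure \<Omega> \<and> lam 0 = p \<and> lam 1 = q
             \<and> is_lift \<phi> lam lh \<and> lh ` {0..1} \<subseteq> cball 0 1 \<and> lh 0 = ph \<and> lh 1 = qh
             \<longrightarrow> lam \<in> hclass \<Omega> p q \<gamma>)"
proof -
  have im: "\<phi> ` ball 0 1 = \<Omega>"
    using assms(5) by (simp add: covering_space_def)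
  then have bd: "bounded (\<phi> ` ball 0 1)"
    using assms(1) by simp
  show ?thesis
  proof (intro conjI ballI allI impI)
    fix lam assume "lam \<in> hclass \<Omega> p q \<gamma>"
    then obtain lh where lh: "is_lift \<phi> lam lh" "lh 0 = gh 0" "lh 1 = gh 1"
      using hclass_imp_lift_with_same_ends[OF assms(4) bd assms(5,3,8,9)] by blast
    moreover have "lh ` {0..1} \<subseteq> cball 0 1"
      using lh(1) radial_dom_subset_cball[of \<phi>] unfolding is_lift_def by blast
    ultimately show "\<exists>lh. is_lift \<phi> lam lh \<and> lh ` {0..1} \<subseteq> cball 0 1 \<and> lh 0 = ph \<and> lh 1 = qh"
      using assms(10,11) by auto
  next
    fix lam lh
    assume "continuous_on {0..1} lam \<and> lam ` {0..1} \<subseteq> closure \<Omega> \<and> lam 0 = p \<and> lam 1 = q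
      \<and> is_lift \<phi> lam lh \<and> lh ` {0..1} \<subseteq> cball 0 1 \<and> lh 0 = ph \<and> lh 1 = qh"
    then show "lam \<in> hclass \<Omega> p q \<gamma>"
      using lift_with_same_ends_in_hclass[OF assms(4) bd _ assms(8,9), of lam lh] im assms(10,11)
      by simp
  qed
qed

end
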